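(* For any integer $n\ge1$, any partition $\pi\vdash n$ with parts $\pi_1,\dots,\pi_{\ell(\pi)}$, and any integer $0\le j\le\ell(\pi)-1$, $$\sum_{k=0}^{n-1}(-1)^k\,\chi_\pi^{\{n|k\}}\,(n-2k-1)^j=\begin{cases}\displaystyle 2^{\ell(\pi)-1}(\ell(\pi)-1)!\prod_{i=1}^{\ell(\pi)}\pi_i,&\text{if }j=\ell(\pi)-1,\\[5pt]0,&\text{if }0\le j\le\ell(\pi)-2.\end{cases}$$
   Context: $\ell(\pi)$ is the number of (nonzero) parts of $\pi$. For $0\le k\le n-1$, $\{n|k\}$ denotes the hook partition $(n-k,1^k)=(n-k,1,\dots,1)$ of $n$ (with $k$ ones). $\chi^\lambda_\pi$ is the value of the irreducible character of the symmetric group $\mathfrak S_n$ indexed by the partition $\lambda\vdash n$ on permutations of cycle type $\pi$. Convention: $0^0=1$. *)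

theory Defs
  imports
    "HOL-Library.Function_Algebras"
    "HOL-Library.Multiset"
    "HOL-Combinatorics.Combinatorics"
    Complex_Main
begin

section \<open>Partitions and cycle types\<close>

definition partition_of :: "nat \<Rightarrow> nat list \<Rightarrow> bool" where
  "partition_of n xs \<longleftrightarrow> sorted_wrt (\<ge>) xs \<and> (\<forall>x\<in>set xs. 0 < x) \<and> sum_list xs = n"

definition hook :: "nat \<Rightarrow> nat \<Rightarrow> nat list" where
  "hook n k = (n - k) # replicate k 1"

text \<open>The symmetric group on \<open>n\<close> letters consists of the \<open>\<sigma>\<close> with \<open>\<sigma> permutes {..<n}\<close>.
  Fixed points contribute parts equal to 1.\<close>

definition cycle_type :: "nat \<Rightarrow> (nat \<Rightarrow> nat) \<Rightarrow> nat multiset" where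
  "cycle_type n \<sigma> = image_mset card (mset_set (orbit \<sigma> ` {..<n}))"

section \<open>Traces of endomorphisms of spaces of complex-valued functions\<close>

definition scale_fun :: "complex \<Rightarrow> ('a \<Rightarrow> complex) \<Rightarrow> 'a \<Rightarrow> complex" where
  "scale_fun c f = (\<lambda>x. c * f x)"

interpretation fun_vs: vector_space scale_fun
  by unfold_locales (auto simp: scale_fun_def fun_eq_iff algebra_simps)

text \<open>Only meaningful when \<open>V\<close> is a finite-dimensional subspace that the linear map \<open>F\<close> maps
  into itself; the value then does not depend on the chosen basis.\<close>

definition trace_on :: "('a \<Rightarrow> complex) set \<Rightarrow> (('a \<Rightarrow> complex) \<Rightarrow> 'a \<Rightarrow> complex) \<Rightarrow> complex" where
  "trace_on V F =
     (let B = (SOME B. fun_vs.independent B \<and> fun_vs.span B = V)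
      in \<Sum>b\<in>B. fun_vs.representation B (F b) b)"

section \<open>Specht modules and irreducible characters\<close>

text \<open>Rows, columns and letters are numbered from 0; the box \<open>(i, j)\<close> lies in row \<open>i\<close> and
  column \<open>j\<close>.\<close>

definition young_diagram :: "nat list \<Rightarrow> (nat \<times> nat) set" where
  "young_diagram \<mu> = {(i, j). i < length \<mu> \<and> j < \<mu> ! i}"

definition is_tableau :: "nat list \<Rightarrow> (nat \<times> nat \<Rightarrow> nat) \<Rightarrow> bool" where
  "is_tableau \<mu> t \<longleftrightarrow> bij_betw t (young_diagram \<mu>) {..<sum_list \<mu>}"

text \<open>A tabloid (a row-equivalence class of tableaux) is represented by the sequence of the sets
  of entries of its rows, continued by empty sets.\<close>

type_synonym tabloid = "nat \<Rightarrow> nat set"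

definition tabloid_of :: "nat list \<Rightarrow> (nat \<times> nat \<Rightarrow> nat) \<Rightarrow> tabloid" where
  "tabloid_of \<mu> t = (\<lambda>i. t ` {(i', j) \<in> young_diagram \<mu>. i' = i})"

definition column_stabilizer :: "nat list \<Rightarrow> (nat \<times> nat \<Rightarrow> nat) \<Rightarrow> (nat \<Rightarrow> nat) set" where
  "column_stabilizer \<mu> t =
     {\<tau>. \<tau> permutes {..<sum_list \<mu>} \<and>
         (\<forall>(i, j) \<in> young_diagram \<mu>. \<exists>i'. (i', j) \<in> young_diagram \<mu> \<and> \<tau> (t (i, j)) = t (i', j))}"

text \<open>The permutation module on tabloids is realised inside the space of complex-valued functions
  on tabloids, a tabloid being identified with its indicator function. The polytabloid of \<open>t\<close> is
  the signed sum of the tabloids of \<open>\<tau> \<circ> t\<close> over the column stabilizer of \<open>t\<close>.\<close>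

definition polytabloid :: "nat list \<Rightarrow> (nat \<times> nat \<Rightarrow> nat) \<Rightarrow> tabloid \<Rightarrow> complex" where
  "polytabloid \<mu> t = (\<lambda>T. \<Sum>\<tau>\<in>column_stabilizer \<mu> t.
     of_int (sign \<tau>) * (if T = tabloid_of \<mu> (\<tau> \<circ> t) then 1 else 0))"

definition specht_module :: "nat list \<Rightarrow> (tabloid \<Rightarrow> complex) set" where
  "specht_module \<mu> = fun_vs.span {polytabloid \<mu> t | t. is_tableau \<mu> t}"

text \<open>Linear extension of the action of \<open>\<sigma>\<close> on tabloids by applying \<open>\<sigma>\<close> to all entries; the
  inverse appears because vectors are functions on tabloids.\<close>

definition perm_action :: "(nat \<Rightarrow> nat) \<Rightarrow> (tabloid \<Rightarrow> complex) \<Rightarrow> tabloid \<Rightarrow> complex" where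
  "perm_action \<sigma> f = (\<lambda>T. f (\<lambda>i. inv \<sigma> ` T i))"

definition specht_character :: "nat list \<Rightarrow> (nat \<Rightarrow> nat) \<Rightarrow> complex" where
  "specht_character \<mu> \<sigma> = trace_on (specht_module \<mu>) (perm_action \<sigma>)"

definition sym_char :: "nat list \<Rightarrow> nat list \<Rightarrow> complex" where
  "sym_char \<mu> \<pi> = (THE c. \<forall>\<sigma>. \<sigma> permutes {..<sum_list \<mu>} \<and> cycle_type (sum_list \<mu>) \<sigma> = mset \<pi>
     \<longrightarrow> specht_character \<mu> \<sigma> = c)"

end

theory Submission
  imports Defs "HOL-Computational_Algebra.Formal_Power_Series"
begin

text \<open>For a hook \<open>(n - k, 1\<^sup>k)\<close> a tabloid is the same thing as an injective sequence
  \<open>x\<^sub>1, \<dots>, x\<^sub>k\<close> of letters, and the polytabloid of a tableau with first column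
  \<open>a\<^sub>0, \<dots>, a\<^sub>k\<close> is the simplicial boundary of the oriented simplex
  \<open>a\<^sub>0 \<and> \<dots> \<and> a\<^sub>k\<close>. So the Specht module is the space of boundaries of the full simplex on the \<open>n\<close>
  letters, which is also its space of cycles: the alternating functions that vanish when summed over
  one entry (\<open>specht_module_hook_eq_cycles\<close>). A cycle is determined by its values on the
  \<open>k\<close>-subsets \<open>A\<close> of the letters other than \<open>0\<close>, and the boundaries of the cones over these
  subsets with apex \<open>0\<close> form the dual basis. Reading the trace off this basis gives (\<open>specht_character_hook\<close>)
  a sum over those \<open>A\<close> of the sign of the permutation of \<open>A \<union> {0}\<close> that agrees on \<open>A\<close> with
  \<open>\<sigma>\<inverse>\<close>; a subset \<open>A\<close> counts only if \<open>\<sigma>\<inverse>\<close> maps it into \<open>A \<union> {0}\<close>.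

  Such a set \<open>A\<close> is an initial piece \<open>\<sigma> 0, \<dots>, \<sigma>\<^sup>r 0\<close> of the cycle through \<open>0\<close>, with
  \<open>r\<close> smaller than the length of this cycle, together with a union of other cycles. The signs and the
  factors \<open>(-1)\<^sup>k\<close> multiply over these pieces, so that the sum of \<open>(-1)\<^sup>k \<chi>\<^sub>k q\<^sup>k\<close> is
  a geometric sum times a product over the remaining cycles
  (\<open>hook_char_generating_function\<close>):
  \<open>(1 - q) \<Sum>\<^sub>k (-1)\<^sup>k \<chi>\<^sub>k q\<^sup>k = \<Prod>\<^sub>i (1 - q ^ \<pi>\<^sub>i)\<close>.
  This holds in every commutative ring. With \<open>q\<close> the variable of a power series ring it shows that
  the character depends only on the cycle type, and with \<open>q = exp (-2 X)\<close> it yields the theorem: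
  after multiplication by \<open>exp ((n - 1) X)\<close>, the \<open>j\<close>-th moment in question is \<open>j!\<close> times the coefficient
  of \<open>X\<^sup>j\<close>, while the right-hand side vanishes at \<open>X = 0\<close> to order \<open>l(\<pi>)\<close> with leading coefficient
  \<open>\<Prod>\<^sub>i 2 \<pi>\<^sub>i\<close>, and the factor \<open>1 - q\<close> is \<open>2 X + \<dots>\<close>.\<close>

section \<open>Traces read off by evaluation\<close>

lemma sum_fun_apply: "(\<Sum>i\<in>I. f i) x = (\<Sum>i\<in>I. f i x)"
  for f :: "'i \<Rightarrow> 'a \<Rightarrow> 'b::comm_monoid_add"
  by (induction I rule: infinite_finite_induct) auto

lemma subspace_basis_choice:
  assumes "fun_vs.subspace V"
  defines "B \<equiv> (SOME B. fun_vs.independent B \<and> fun_vs.span B = V)"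
  shows "fun_vs.independent B" and "fun_vs.span B = V"
proof -
  obtain B' where "B' \<subseteq> V" "fun_vs.independent B'" "V \<subseteq> fun_vs.span B'"
    using fun_vs.maximal_independent_subset[of V] by blast
  then have "fun_vs.independent B' \<and> fun_vs.span B' = V"
    using assms(1) fun_vs.span_minimal[of B' V] by blast
  then have "fun_vs.independent B \<and> fun_vs.span B = V"
    unfolding B_def by (rule someI)
  then show "fun_vs.independent B" "fun_vs.span B = V" by auto
qed

text \<open>If every vector \<open>f\<close> of \<open>V\<close> is the combination of the vectors \<open>e i\<close> with coefficients \<open>f (p i)\<close>, then
  \<open>\<Sum>\<^sub>b rep (F b) b = \<Sum>\<^sub>i \<Sum>\<^sub>b b (p i) rep (F (e i)) b = \<Sum>\<^sub>i F (e i) (p i)\<close> for every basis,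
  where \<open>rep v b\<close> is the coordinate of \<open>v\<close> at the basis vector \<open>b\<close>.
  This frees the trace from the chosen basis and at the same time computes it.\<close>
lemma trace_on_eq_sum_evaluations:
  fixes e :: "'i \<Rightarrow> 'a \<Rightarrow> complex" and p :: "'i \<Rightarrow> 'a"
  assumes fin: "finite I" and V: "fun_vs.subspace V"
    and e: "\<And>i. i \<in> I \<Longrightarrow> e i \<in> V"
    and expand: "\<And>f. f \<in> V \<Longrightarrow> f = (\<Sum>i\<in>I. scale_fun (f (p i)) (e i))"
    and lin: "Vector_Spaces.linear scale_fun scale_fun F"
    and inv: "\<And>f. f \<in> V \<Longrightarrow> F f \<in> V"
  shows "trace_on V F = (\<Sum>i\<in>I. F (e i) (p i))"
proof -
  define B where "B = (SOME B. fun_vs.independent B \<and> fun_vs.span B = V)"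
  have ind: "fun_vs.independent B" and span: "fun_vs.span B = V"
    using subspace_basis_choice[OF V] unfolding B_def by auto
  interpret F: Vector_Spaces.linear scale_fun scale_fun F by (rule lin)
  have "V \<subseteq> fun_vs.span (e ` I)"
  proof
    fix f assume "f \<in> V"
    from expand[OF this] show "f \<in> fun_vs.span (e ` I)"
      by (metis (no_types, lifting) fun_vs.span_base fun_vs.span_scale fun_vs.span_sum imageI)
  qed
  then have finB: "finite B"
    using fun_vs.independent_span_bound[OF _ ind, of "e ` I"] fin span fun_vs.span_superset[of B]
    by blast
  have BV: "b \<in> V" if "b \<in> B" for b
    using that span fun_vs.span_base by auto
  have diag: "fun_vs.representation B (F b) b
      = (\<Sum>i\<in>I. b (p i) * fun_vs.representation B (F (e i)) b)" if b: "b \<in> B" for b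
  proof -
    have Fe: "F (e i) \<in> fun_vs.span B" if "i \<in> I" for i
      using inv e that span by auto
    have "F b = (\<Sum>i\<in>I. scale_fun (b (p i)) (F (e i)))"
      by (subst expand[OF BV[OF b]]) (simp add: F.sum F.scale)
    then show ?thesis
      using Fe by (simp add: fun_vs.representation_sum fun_vs.representation_scale
          fun_vs.span_scale ind)
  qed
  have "trace_on V F = (\<Sum>b\<in>B. fun_vs.representation B (F b) b)"
    by (simp add: trace_on_def B_def Let_def)
  also have "\<dots> = (\<Sum>i\<in>I. \<Sum>b\<in>B. fun_vs.representation B (F (e i)) b * b (p i))"
    by (simp add: diag sum.swap[of _ B] mult.commute)
  also have "\<dots> = (\<Sum>i\<in>I. F (e i) (p i))"
  proof (rule sum.cong[OF refl])
    fix i assume "i \<in> I"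
    then have "F (e i) \<in> fun_vs.span B" using inv e span by auto
    then have "(\<Sum>b\<in>B. scale_fun (fun_vs.representation B (F (e i)) b) b) = F (e i)"
      using fun_vs.sum_representation_eq[OF ind _ finB] by auto
    from fun_cong[OF this, of "p i"]
    show "(\<Sum>b\<in>B. fun_vs.representation B (F (e i)) b * b (p i)) = F (e i) (p i)"
      by (simp add: sum_fun_apply scale_fun_def)
  qed
  finally show ?thesis .
qed

section \<open>Hook tabloids and hook polytabloids\<close>

text \<open>A hook tabloid is determined by its one-letter rows, so sequences \<open>x 1, \<dots>, x k\<close> serve as coordinates for
  tabloids; values of \<open>x\<close> at other arguments have no influence.\<close>
definition hook_tabloid :: "nat \<Rightarrow> nat \<Rightarrow> (nat \<Rightarrow> nat) \<Rightarrow> tabloid" where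
  "hook_tabloid n k x =
     (\<lambda>i. if i = 0 then {..<n} - x ` {1..k} else if i \<le> k then {x i} else {})"

text \<open>Only the first column \<open>a 0, \<dots>, a k\<close> of a hook tableau influences its polytabloid, because the other
  columns have a single box.\<close>
definition hook_polytabloid :: "nat \<Rightarrow> nat \<Rightarrow> (nat \<Rightarrow> nat) \<Rightarrow> tabloid \<Rightarrow> complex" where
  "hook_polytabloid n k a = (\<lambda>T. \<Sum>\<tau> | \<tau> permutes a ` {..k}.
     of_int (sign \<tau>) * of_bool (T = hook_tabloid n k (\<tau> \<circ> a)))"

lemma hook_tabloid_eq_iff:
  "hook_tabloid n k x = hook_tabloid n k y \<longleftrightarrow> (\<forall>i\<in>{1..k}. x i = y i)"
proof
  assume eq: "hook_tabloid n k x = hook_tabloid n k y"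
  show "\<forall>i\<in>{1..k}. x i = y i"
  proof
    fix i assume "i \<in> {1..k}"
    then show "x i = y i"
      using fun_cong[OF eq, of i] by (auto simp: hook_tabloid_def)
  qed
next
  assume "\<forall>i\<in>{1..k}. x i = y i"
  moreover from this have "x ` {1..k} = y ` {1..k}" by (intro image_cong) auto
  ultimately show "hook_tabloid n k x = hook_tabloid n k y"
    by (auto simp: hook_tabloid_def fun_eq_iff)
qed

lemma in_young_diagram_hook:
  assumes "k < n"
  shows "(i, j) \<in> young_diagram (hook n k) \<longleftrightarrow> i = 0 \<and> j < n - k \<or> 1 \<le> i \<and> i \<le> k \<and> j = 0"
  using assms by (cases i) (auto simp: young_diagram_def hook_def)

lemma sum_list_hook: "k < n \<Longrightarrow> sum_list (hook n k) = n"
  by (simp add: hook_def sum_list_replicate)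

context
  fixes n k :: nat and t :: "nat \<times> nat \<Rightarrow> nat"
  assumes k: "k < n" and t: "is_tableau (hook n k) t"
begin

lemma hook_tableau_bij: "bij_betw t (young_diagram (hook n k)) {..<n}"
  using t by (simp add: is_tableau_def sum_list_hook[OF k])

lemma hook_column_letters:
  "inj_on (\<lambda>i. t (i, 0)) {..k}" "(\<lambda>i. t (i, 0)) ` {..k} \<subseteq> {..<n}"
proof -
  have mem: "(i, 0) \<in> young_diagram (hook n k)" if "i \<le> k" for i
    using that k by (subst in_young_diagram_hook) auto
  show "inj_on (\<lambda>i. t (i, 0)) {..k}"
    using hook_tableau_bij mem unfolding bij_betw_def inj_on_def by (metis atMost_iff prod.inject)
  show "(\<lambda>i. t (i, 0)) ` {..k} \<subseteq> {..<n}"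
    using hook_tableau_bij mem unfolding bij_betw_def by blast
qed

lemma column_stabilizer_hook:
  "column_stabilizer (hook n k) t = {\<tau>. \<tau> permutes (\<lambda>i. t (i, 0)) ` {..k}}"
    (is "?L = {\<tau>. \<tau> permutes ?S}")
proof (intro set_eqI iffI; unfold mem_Collect_eq)
  fix \<tau> assume "\<tau> \<in> ?L"
  then have perm: "\<tau> permutes {..<n}" and
    col: "\<And>i j. (i, j) \<in> young_diagram (hook n k) \<Longrightarrow>
       \<exists>i'. (i', j) \<in> young_diagram (hook n k) \<and> \<tau> (t (i, j)) = t (i', j)"
    by (auto simp: column_stabilizer_def sum_list_hook[OF k])
  show "\<tau> permutes ?S"
  proof (rule permutes_superset[OF perm])
    fix x assume x: "x \<in> {..<n} - ?S"
    then obtain i j where ij: "(i, j) \<in> young_diagram (hook n k)" "x = t (i, j)"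
      using hook_tableau_bij unfolding bij_betw_def by (metis DiffD1 imageE surj_pair)
    have "j \<noteq> 0" using ij x k by (auto simp: in_young_diagram_hook)
    with ij col[OF ij(1)] show "\<tau> x = x"
      using k by (auto simp: in_young_diagram_hook)
  qed
next
  fix \<tau> assume perm: "\<tau> permutes ?S"
  have "\<exists>i'. (i', j) \<in> young_diagram (hook n k) \<and> \<tau> (t (i, j)) = t (i', j)"
    if ij: "(i, j) \<in> young_diagram (hook n k)" for i j
  proof (cases "j = 0")
    case True
    then have "t (i, j) \<in> ?S" using ij k by (auto simp: in_young_diagram_hook)
    then have "\<tau> (t (i, j)) \<in> ?S" using perm by (simp add: permutes_in_image)
    then show ?thesis using True k by (auto simp: in_young_diagram_hook)
  next
    case False
    have "t (i, j) \<notin> ?S"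
    proof
      assume "t (i, j) \<in> ?S"
      then obtain i' where i': "i' \<le> k" "t (i, j) = t (i', 0)" by auto
      then have "(i', 0) \<in> young_diagram (hook n k)"
        using k by (subst in_young_diagram_hook) auto
      with ij i' have "(i, j) = (i', 0)"
        using hook_tableau_bij unfolding bij_betw_def inj_on_def by blast
      with False show False by simp
    qed
    then have "\<tau> (t (i, j)) = t (i, j)" using perm by (simp add: permutes_not_in)
    with ij show ?thesis by auto
  qed
  then show "\<tau> \<in> ?L"
    using permutes_subset[OF perm hook_column_letters(2)]
    by (auto simp: column_stabilizer_def sum_list_hook[OF k])
qed

lemma tabloid_of_hook:
  assumes "\<tau> permutes {..<n}"
  shows "tabloid_of (hook n k) (\<tau> \<circ> t) = hook_tabloid n k (\<tau> \<circ> (\<lambda>i. t (i, 0)))"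
proof
  fix i
  have bij: "bij_betw (\<tau> \<circ> t) (young_diagram (hook n k)) {..<n}"
    using bij_betw_trans[OF hook_tableau_bij permutes_imp_bij[OF assms]] .
  show "tabloid_of (hook n k) (\<tau> \<circ> t) i = hook_tabloid n k (\<tau> \<circ> (\<lambda>i. t (i, 0))) i"
  proof (cases "i = 0")
    case True
    define R where "R = {(i', j) \<in> young_diagram (hook n k). i' = 0}"
    define C where "C = (\<lambda>i. (i, 0::nat)) ` {1..k}"
    have "R \<union> C = young_diagram (hook n k)" "R \<inter> C = {}"
      using k by (auto simp: R_def C_def in_young_diagram_hook image_iff)
    then have "R = young_diagram (hook n k) - C" "C \<subseteq> young_diagram (hook n k)" by auto
    then have "(\<tau> \<circ> t) ` R = {..<n} - (\<tau> \<circ> t) ` C"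
      using bij inj_on_image_set_diff[of "\<tau> \<circ> t" "young_diagram (hook n k)"
          "young_diagram (hook n k)" C]
      by (auto simp: bij_betw_def)
    then show ?thesis
      using True by (simp add: tabloid_of_def hook_tabloid_def R_def C_def image_image)
  next
    case False
    then have "{(i', j) \<in> young_diagram (hook n k). i' = i} = (if i \<le> k then {(i, 0)} else {})"
      using k by (auto simp: in_young_diagram_hook)
    then show ?thesis using False by (simp add: tabloid_of_def hook_tabloid_def)
  qed
qed

lemma polytabloid_hook:
  "polytabloid (hook n k) t = hook_polytabloid n k (\<lambda>i. t (i, 0))"
proof
  fix T
  show "polytabloid (hook n k) t T = hook_polytabloid n k (\<lambda>i. t (i, 0)) T"
    unfolding polytabloid_def hook_polytabloid_def column_stabilizer_hook
  proof (rule sum.cong[OF refl])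
    fix \<tau> assume "\<tau> \<in> {\<tau>. \<tau> permutes (\<lambda>i. t (i, 0)) ` {..k}}"
    then have "\<tau> permutes {..<n}"
      using permutes_subset[OF _ hook_column_letters(2)] by auto
    from tabloid_of_hook[OF this]
    show "of_int (sign \<tau>) * (if T = tabloid_of (hook n k) (\<tau> \<circ> t) then 1 else 0)
      = (of_int (sign \<tau>) * of_bool (T = hook_tabloid n k (\<tau> \<circ> (\<lambda>i. t (i, 0)))) :: complex)"
      by simp
  qed
qed

end

lemma hook_tableau_with_column:
  assumes k: "k < n" and a: "inj_on a {..k}" "a ` {..k} \<subseteq> {..<n}"
  obtains t where "is_tableau (hook n k) t" "\<And>i. t (i, 0) = a i"
proof -
  define R where "R = Pair (0::nat) ` {1..<n - k}"
  define C where "C = (\<lambda>i. (i, 0::nat)) ` {..k}"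
  have card_eq: "card R = card ({..<n} - a ` {..k})"
    unfolding R_def using a k by (subst card_image) (auto simp: inj_on_def card_Diff_subset card_image)
  then obtain g where g: "bij_betw g R ({..<n} - a ` {..k})"
    using finite_same_card_bij[OF _ _ card_eq] by (auto simp: R_def)
  define t where "t = (\<lambda>(i, j). if j = 0 then a i else g (i, j))"
  have "bij_betw t R ({..<n} - a ` {..k})"
    using g by (subst bij_betw_cong[where g = g]) (auto simp: R_def t_def)
  moreover have "bij_betw t C (a ` {..k})"
    using a(1) unfolding bij_betw_def C_def t_def by (auto simp: inj_on_def image_image)
  ultimately have "bij_betw t (R \<union> C) (({..<n} - a ` {..k}) \<union> a ` {..k})"
    by (rule bij_betw_combine) auto
  moreover have "R \<union> C = young_diagram (hook n k)"
  proof (intro set_eqI)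
    fix p :: "nat \<times> nat"
    show "p \<in> R \<union> C \<longleftrightarrow> p \<in> young_diagram (hook n k)"
      using k by (cases p) (auto simp: in_young_diagram_hook R_def C_def image_iff)
  qed
  moreover have "({..<n} - a ` {..k}) \<union> a ` {..k} = {..<n}" using a(2) by auto
  ultimately have "is_tableau (hook n k) t"
    by (simp add: is_tableau_def sum_list_hook[OF k])
  then show thesis by (rule that) (simp add: t_def)
qed

text \<open>Every injective column extends to a tableau, so the generators may be indexed by columns alone.\<close>
lemma specht_module_hook:
  assumes k: "k < n"
  shows "specht_module (hook n k) =
    fun_vs.span {hook_polytabloid n k a | a. inj_on a {..k} \<and> a ` {..k} \<subseteq> {..<n}}"
proof -
  have "{polytabloid (hook n k) t | t. is_tableau (hook n k) t}
      = {hook_polytabloid n k a | a. inj_on a {..k} \<and> a ` {..k} \<subseteq> {..<n}}"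
  proof (intro set_eqI iffI)
    fix f assume "f \<in> {polytabloid (hook n k) t | t. is_tableau (hook n k) t}"
    then obtain t where t: "f = polytabloid (hook n k) t" "is_tableau (hook n k) t" by blast
    then show "f \<in> {hook_polytabloid n k a | a. inj_on a {..k} \<and> a ` {..k} \<subseteq> {..<n}}"
      using polytabloid_hook[OF k t(2)] hook_column_letters[OF k t(2)] by blast
  next
    fix f assume "f \<in> {hook_polytabloid n k a | a. inj_on a {..k} \<and> a ` {..k} \<subseteq> {..<n}}"
    then obtain a where a: "f = hook_polytabloid n k a" "inj_on a {..k}" "a ` {..k} \<subseteq> {..<n}"
      by blast
    obtain t where t: "is_tableau (hook n k) t" "\<And>i. t (i, 0) = a i"
      using hook_tableau_with_column[OF k a(2,3)] by blast
    then have "f = polytabloid (hook n k) t"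
      using polytabloid_hook[OF k t(1)] a(1) by simp
    with t show "f \<in> {polytabloid (hook n k) t | t. is_tableau (hook n k) t}" by blast
  qed
  then show ?thesis by (simp add: specht_module_def)
qed

section \<open>Hook Specht modules as spaces of cycles\<close>

text \<open>Simplicial \<open>(k - 1)\<close>-cycles (for the augmented complex) on the letters \<open>0, \<dots>, n - 1\<close>,
  written as functions on tabloids: they live on injective sequences, are alternating, and have boundary zero. The boundary sum runs over all
  letters \<open>y\<close>; those that repeat an entry contribute nothing because of the support condition.\<close>
definition hook_cycles :: "nat \<Rightarrow> nat \<Rightarrow> (tabloid \<Rightarrow> complex) set" where
  "hook_cycles n k = {f.
     (\<forall>T. f T \<noteq> 0 \<longrightarrow> (\<exists>x. inj_on x {1..k} \<and> x ` {1..k} \<subseteq> {..<n} \<and> T = hook_tabloid n k x)) \<and>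
     (\<forall>x \<rho>. \<rho> permutes {1..k} \<longrightarrow>
        f (hook_tabloid n k (x \<circ> \<rho>)) = of_int (sign \<rho>) * f (hook_tabloid n k x)) \<and>
     (\<forall>x. 1 \<le> k \<longrightarrow> (\<Sum>y<n. f (hook_tabloid n k (x(1 := y)))) = 0)}"

lemma hook_cyclesI:
  assumes "\<And>T. f T \<noteq> 0 \<Longrightarrow>
      \<exists>x. inj_on x {1..k} \<and> x ` {1..k} \<subseteq> {..<n} \<and> T = hook_tabloid n k x"
    and "\<And>x \<rho>. \<rho> permutes {1..k} \<Longrightarrow>
      f (hook_tabloid n k (x \<circ> \<rho>)) = of_int (sign \<rho>) * f (hook_tabloid n k x)"
    and "\<And>x. 1 \<le> k \<Longrightarrow> (\<Sum>y<n. f (hook_tabloid n k (x(1 := y)))) = 0"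
  shows "f \<in> hook_cycles n k"
  using assms unfolding hook_cycles_def by blast

lemma hook_cycles_support:
  assumes "f \<in> hook_cycles n k" "f (hook_tabloid n k x) \<noteq> 0"
  shows "inj_on x {1..k}" "x ` {1..k} \<subseteq> {..<n}"
proof -
  from assms obtain z where z: "inj_on z {1..k}" "z ` {1..k} \<subseteq> {..<n}"
    and "hook_tabloid n k x = hook_tabloid n k z"
    unfolding hook_cycles_def by blast
  then have eq: "x i = z i" if "i \<in> {1..k}" for i using that by (simp add: hook_tabloid_eq_iff)
  from z(1) show "inj_on x {1..k}" by (subst inj_on_cong[OF eq])
  from z(2) show "x ` {1..k} \<subseteq> {..<n}" using eq by auto
qed

lemma hook_cycles_alternating:
  "\<lbrakk>f \<in> hook_cycles n k; \<rho> permutes {1..k}\<rbrakk> \<Longrightarrow>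
     f (hook_tabloid n k (x \<circ> \<rho>)) = of_int (sign \<rho>) * f (hook_tabloid n k x)"
  by (simp add: hook_cycles_def)

lemma hook_cycles_boundary:
  "\<lbrakk>f \<in> hook_cycles n k; 1 \<le> k\<rbrakk> \<Longrightarrow> (\<Sum>y<n. f (hook_tabloid n k (x(1 := y)))) = 0"
  by (simp add: hook_cycles_def)

lemma subspace_hook_cycles: "fun_vs.subspace (hook_cycles n k)"
  unfolding fun_vs.subspace_def
proof (intro conjI ballI allI)
  show "0 \<in> hook_cycles n k" by (simp add: hook_cycles_def)
next
  fix f g assume f: "f \<in> hook_cycles n k" and g: "g \<in> hook_cycles n k"
  show "f + g \<in> hook_cycles n k"
  proof (rule hook_cyclesI)
    fix T assume "(f + g) T \<noteq> 0"
    then have "f T \<noteq> 0 \<or> g T \<noteq> 0" by auto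
    then show "\<exists>x. inj_on x {1..k} \<and> x ` {1..k} \<subseteq> {..<n} \<and> T = hook_tabloid n k x"
      using f g unfolding hook_cycles_def by blast
  qed (use f g in \<open>simp_all add: hook_cycles_alternating hook_cycles_boundary sum.distrib
      distrib_left del: One_nat_def\<close>)
next
  fix c f assume f: "f \<in> hook_cycles n k"
  show "scale_fun c f \<in> hook_cycles n k"
  proof (rule hook_cyclesI)
    fix T assume "scale_fun c f T \<noteq> 0"
    then have "f T \<noteq> 0" by (auto simp: scale_fun_def)
    then show "\<exists>x. inj_on x {1..k} \<and> x ` {1..k} \<subseteq> {..<n} \<and> T = hook_tabloid n k x"
      using f unfolding hook_cycles_def by blast
  qed (use f in \<open>simp_all add: scale_fun_def hook_cycles_alternating hook_cycles_boundary
      sum_distrib_left[symmetric] del: One_nat_def\<close>)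
qed

lemma hook_polytabloid_at_hook_tabloid:
  "hook_polytabloid n k a (hook_tabloid n k x) =
    (\<Sum>\<tau> | \<tau> permutes a ` {..k}. of_int (sign \<tau>) * of_bool (\<forall>i\<in>{1..k}. \<tau> (a i) = x i))"
proof -
  have "hook_tabloid n k x = hook_tabloid n k (\<tau> \<circ> a) \<longleftrightarrow> (\<forall>i\<in>{1..k}. \<tau> (a i) = x i)" for \<tau>
    unfolding hook_tabloid_eq_iff comp_apply by metis
  then show ?thesis by (simp only: hook_polytabloid_def)
qed

lemma sum_sign_compose_right:
  fixes g :: "('a \<Rightarrow> 'a) \<Rightarrow> 'b::comm_ring_1"
  assumes "finite S" "\<theta> permutes S"
  shows "(\<Sum>\<tau> | \<tau> permutes S. of_int (sign \<tau>) * g (\<tau> \<circ> \<theta>)) =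
    of_int (sign \<theta>) * (\<Sum>\<tau> | \<tau> permutes S. of_int (sign \<tau>) * g \<tau>)"
proof -
  have "of_int (sign \<theta>) * (\<Sum>\<tau> | \<tau> permutes S. of_int (sign \<tau>) * g \<tau>)
      = of_int (sign \<theta>) * (\<Sum>\<tau> | \<tau> permutes S. of_int (sign (\<tau> \<circ> \<theta>)) * g (\<tau> \<circ> \<theta>))"
    by (subst sum_permutations_compose_right[OF assms(2)]) simp
  also have "\<dots> = (\<Sum>\<tau> | \<tau> permutes S. of_int (sign \<tau>) * g (\<tau> \<circ> \<theta>))"
    unfolding sum_distrib_left
  proof (intro sum.cong refl)
    fix \<tau> assume "\<tau> \<in> {\<tau>. \<tau> permutes S}"
    then have "sign (\<tau> \<circ> \<theta>) = sign \<tau> * sign \<theta>"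
      using assms by (intro sign_compose permutes_imp_permutation) auto
    moreover have "of_int (sign \<theta>) * of_int (sign \<theta>) = (1 :: 'b)"
      by (metis of_int_1 of_int_mult sign_idempotent)
    moreover have "of_int (sign \<theta>) * (of_int (sign \<tau> * sign \<theta>) * g (\<tau> \<circ> \<theta>))
        = of_int (sign \<tau>) * g (\<tau> \<circ> \<theta>) * (of_int (sign \<theta>) * of_int (sign \<theta>))"
      by (simp add: algebra_simps)
    ultimately show "of_int (sign \<theta>) * (of_int (sign (\<tau> \<circ> \<theta>)) * g (\<tau> \<circ> \<theta>))
        = of_int (sign \<tau>) * g (\<tau> \<circ> \<theta>)"
      by simp
  qed
  finally show ?thesis by simp
qed

text \<open>Both symmetries come from composing the permutations of the column with a fixed one: permuting the
  entries \<open>a 1, \<dots>, a k\<close> gives the alternating law, and exchanging \<open>a 0\<close> with \<open>a 1\<close> leaves the entries in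
  rows \<open>2, \<dots>, k\<close> alone but reverses the sign, which makes the boundary cancel.\<close>
lemma hook_polytabloid_in_hook_cycles:
  assumes a: "inj_on a {..k}" "a ` {..k} \<subseteq> {..<n}"
  shows "hook_polytabloid n k a \<in> hook_cycles n k"
proof -
  define S where "S = a ` {..k}"
  have fin: "finite S" by (simp add: S_def)
  have supp: "\<exists>x. inj_on x {1..k} \<and> x ` {1..k} \<subseteq> {..<n} \<and> T = hook_tabloid n k x"
    if "hook_polytabloid n k a T \<noteq> 0" for T
  proof -
    obtain \<tau> where \<tau>: "\<tau> permutes S" "T = hook_tabloid n k (\<tau> \<circ> a)"
    proof (rule ccontr)
      assume "\<not> thesis"
      with that have "hook_polytabloid n k a T = 0"
        unfolding hook_polytabloid_def S_def by (intro sum.neutral) auto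
      with \<open>hook_polytabloid n k a T \<noteq> 0\<close> show False by simp
    qed
    have "inj_on (\<tau> \<circ> a) {..k}"
      using a(1) permutes_inj_on[OF \<tau>(1)] by (rule comp_inj_on)
    then have "inj_on (\<tau> \<circ> a) {1..k}" by (rule inj_on_subset) auto
    moreover have "(\<tau> \<circ> a) ` {..k} \<subseteq> {..<n}"
      using a(2) \<tau>(1) unfolding S_def image_comp[symmetric] by (simp add: permutes_image)
    then have "(\<tau> \<circ> a) ` {1..k} \<subseteq> {..<n}" by (auto simp: image_subset_iff)
    ultimately show ?thesis using \<tau>(2) by blast
  qed
  have alt: "hook_polytabloid n k a (hook_tabloid n k (x \<circ> \<rho>))
      = of_int (sign \<rho>) * hook_polytabloid n k a (hook_tabloid n k x)"
    if \<rho>: "\<rho> permutes {1..k}" for x \<rho>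
  proof -
    have \<rho>': "\<rho> permutes {..k}" using \<rho> by (rule permutes_subset) auto
    define \<theta> where "\<theta> = map_permutation {..k} a \<rho>"
    have \<theta>: "\<theta> permutes S"
      unfolding \<theta>_def S_def using \<rho>' a(1) by (intro map_permutation_permutes) (auto simp: bij_betw_def)
    have sgn: "sign \<theta> = sign \<rho>"
      unfolding \<theta>_def using \<rho>' a(1) by (intro sign_map_permutation) auto
    have \<theta>a: "\<theta> (a i) = a (\<rho> i)" if "i \<in> {1..k}" for i
      unfolding \<theta>_def using a(1) that by (intro map_permutation_apply) auto
    have "(\<forall>i\<in>{1..k}. \<tau> (a i) = x i) \<longleftrightarrow> (\<forall>i\<in>{1..k}. (\<tau> \<circ> \<theta>) (a i) = (x \<circ> \<rho>) i)" for \<tau>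
    proof -
      have "(\<forall>i\<in>{1..k}. \<tau> (a i) = x i) \<longleftrightarrow> (\<forall>i\<in>\<rho> ` {1..k}. \<tau> (a i) = x i)"
        by (simp only: permutes_image[OF \<rho>])
      then show ?thesis by (simp add: \<theta>a)
    qed
    then have "of_int (sign \<theta>) * hook_polytabloid n k a (hook_tabloid n k (x \<circ> \<rho>))
      = hook_polytabloid n k a (hook_tabloid n k x)"
      unfolding hook_polytabloid_at_hook_tabloid S_def[symmetric]
      by (subst sum_sign_compose_right[OF fin \<theta>, symmetric]) simp
    moreover have "of_int (sign \<theta>) * of_int (sign \<theta>) = (1 :: complex)"
      by (metis of_int_1 of_int_mult sign_idempotent)
    ultimately show ?thesis by (metis sgn mult.assoc mult_1)
  qed
  have bd: "(\<Sum>y<n. hook_polytabloid n k a (hook_tabloid n k (x(1 := y)))) = 0" if k: "1 \<le> k" for x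
  proof -
    define \<theta> where "\<theta> = transpose (a 0) (a 1)"
    have mem: "a 0 \<in> S" "a 1 \<in> S" using k by (auto simp: S_def)
    have \<theta>: "\<theta> permutes S" unfolding \<theta>_def using mem by (rule permutes_swap_id)
    have "a 0 \<noteq> a 1" using a(1) k by (auto simp: inj_on_def)
    then have sgn: "sign \<theta> = - 1" by (simp add: \<theta>_def sign_swap_id)
    \<comment> \<open>agreement in the rows from \<open>2\<close> on; row \<open>1\<close> then matches for exactly one letter \<open>y\<close>\<close>
    define M where "M = (\<lambda>\<tau>. of_bool (\<forall>i\<in>{2..k}. \<tau> (a i) = x i) :: complex)"
    have split: "{1..k} = insert 1 {2..k}" using k by auto
    have "(\<Sum>y<n. of_bool (\<forall>i\<in>{1..k}. \<tau> (a i) = (x(1 := y)) i)) = M \<tau>" if "\<tau> permutes S" for \<tau>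
    proof -
      have "\<tau> (a 1) \<in> S" using that mem by (simp add: permutes_in_image)
      then have "\<tau> (a 1) < n" using a(2) by (auto simp: S_def)
      have "(\<forall>i\<in>{1..k}. \<tau> (a i) = (x(1 := y)) i)
          \<longleftrightarrow> y = \<tau> (a 1) \<and> (\<forall>i\<in>{2..k}. \<tau> (a i) = x i)" for y
        unfolding split by auto
      then have "(\<Sum>y<n. of_bool (\<forall>i\<in>{1..k}. \<tau> (a i) = (x(1 := y)) i))
          = (\<Sum>y<n. if y = \<tau> (a 1) then M \<tau> else 0)"
        by (intro sum.cong refl) (simp add: M_def)
      then show ?thesis using \<open>\<tau> (a 1) < n\<close> by simp
    qed
    then have "(\<Sum>y<n. hook_polytabloid n k a (hook_tabloid n k (x(1 := y))))
        = (\<Sum>\<tau> | \<tau> permutes S. of_int (sign \<tau>) * M \<tau>)" (is "?s = ?m")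
      unfolding hook_polytabloid_at_hook_tabloid S_def[symmetric]
      by (subst sum.swap) (simp add: sum_distrib_left[symmetric])
    moreover have "?m = - ?m"
    proof -
      have "M (\<tau> \<circ> \<theta>) = M \<tau>" for \<tau>
      proof -
        have "\<theta> (a i) = a i" if "i \<in> {2..k}" for i
          unfolding \<theta>_def
          using that k inj_on_eq_iff[OF a(1), of i 0] inj_on_eq_iff[OF a(1), of i 1]
          by (intro transpose_apply_other) auto
        then show ?thesis by (simp add: M_def)
      qed
      then show ?thesis
        using sum_sign_compose_right[OF fin \<theta>, of M] by (simp add: sgn)
    qed
    ultimately show ?thesis by simp
  qed
  show ?thesis by (rule hook_cyclesI) (fact supp alt bd)+
qed

text \<open>The first column of the standard hook tableau whose letters below the corner form the set \<open>A\<close>.\<close>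
definition standard_column :: "nat set \<Rightarrow> nat \<Rightarrow> nat" where
  "standard_column A = (\<lambda>i. if i = 0 then 0 else sorted_list_of_set A ! (i - 1))"

lemma standard_column_bij:
  assumes "finite A"
  shows "bij_betw (standard_column A) {1..card A} A"
proof -
  have "bij_betw (\<lambda>i. sorted_list_of_set A ! i) {..<card A} A"
    using assms by (intro bij_betw_nth) auto
  moreover have "bij_betw (\<lambda>i. i - 1) {1..card A} {..<card A}"
    by (rule bij_betw_byWitness[where f' = Suc]) auto
  ultimately have "bij_betw ((\<lambda>i. sorted_list_of_set A ! i) \<circ> (\<lambda>i. i - 1)) {1..card A} A"
    by (rule bij_betw_trans[rotated])
  then show ?thesis
    by (subst bij_betw_cong[where g = "(\<lambda>i. sorted_list_of_set A ! i) \<circ> (\<lambda>i. i - 1)"])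
      (auto simp: standard_column_def)
qed

lemma standard_column_0 [simp]: "standard_column A 0 = 0"
  by (simp add: standard_column_def)

lemma standard_column_bij_insert:
  assumes "finite A" "0 \<notin> A"
  shows "bij_betw (standard_column A) {..card A} (insert 0 A)"
proof -
  have "bij_betw (standard_column A) ({1..card A} \<union> {0}) (A \<union> {0})"
    using assms by (intro bij_betw_combine standard_column_bij) auto
  moreover have "{1..card A} \<union> {0} = {..card A}" by auto
  ultimately show ?thesis by simp
qed

text \<open>Alternation moves any sequence avoiding the letter \<open>0\<close> to a standard one; if \<open>0\<close> occurs, it may be moved
  to row \<open>1\<close>, and then the boundary equation expresses the value through sequences avoiding \<open>0\<close>.\<close>
lemma hook_cycle_eq_0I:
  assumes f: "f \<in> hook_cycles n k"
    and zero: "\<And>A. \<lbrakk>A \<subseteq> {1..<n}; card A = k\<rbrakk> \<Longrightarrow> f (hook_tabloid n k (standard_column A)) = 0"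
  shows "f = 0"
proof (rule ccontr)
  have no0: "f (hook_tabloid n k x) = 0" if x: "0 \<notin> x ` {1..k}" for x
  proof (rule ccontr)
    assume nz: "f (hook_tabloid n k x) \<noteq> 0"
    note inj = hook_cycles_support[OF f nz]
    define A where "A = x ` {1..k}"
    have A: "finite A" "card A = k" "A \<subseteq> {1..<n}"
      using inj x by (auto simp: A_def card_image Suc_le_eq image_subset_iff intro!: gr0I)
    define s where "s = standard_column A"
    have s: "bij_betw s {1..k} A" using standard_column_bij[OF A(1)] A(2) by (simp add: s_def)
    define \<rho> where "\<rho> = (\<lambda>i. if i \<in> {1..k} then inv_into {1..k} s (x i) else i)"
    have "bij_betw (inv_into {1..k} s \<circ> x) {1..k} {1..k}"
      using bij_betw_trans[OF inj_on_imp_bij_betw[OF inj(1)]] bij_betw_inv_into[OF s]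
      unfolding A_def by blast
    then have "bij_betw \<rho> {1..k} {1..k}"
      by (subst bij_betw_cong[where g = "inv_into {1..k} s \<circ> x"]) (auto simp: \<rho>_def)
    then have \<rho>: "\<rho> permutes {1..k}" by (rule bij_imp_permutes) (auto simp: \<rho>_def)
    have "hook_tabloid n k x = hook_tabloid n k (s \<circ> \<rho>)"
      unfolding hook_tabloid_eq_iff using s
      by (auto simp: \<rho>_def A_def bij_betw_def f_inv_into_f)
    then show False
      using nz hook_cycles_alternating[OF f \<rho>, of s] zero[OF A(3,2)] by (simp add: s_def)
  qed
  assume "f \<noteq> 0"
  then obtain T where "f T \<noteq> 0" by (auto simp: fun_eq_iff)
  then obtain x where nz: "f (hook_tabloid n k x) \<noteq> 0" using f unfolding hook_cycles_def by auto
  then have "0 \<in> x ` {1..k}" using no0 by blast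
  then obtain i where i: "i \<in> {1..k}" "x i = 0" by (metis imageE)
  define \<rho> where "\<rho> = transpose 1 i"
  have \<rho>: "\<rho> permutes {1..k}" unfolding \<rho>_def using i by (intro permutes_swap_id) auto
  define z where "z = x \<circ> \<rho>"
  have z1: "z 1 = 0" using i by (simp add: z_def \<rho>_def)
  have nz': "f (hook_tabloid n k z) \<noteq> 0"
    using nz hook_cycles_alternating[OF f \<rho>, of x] by (simp add: z_def)
  note inj = hook_cycles_support[OF f nz']
  have rest: "f (hook_tabloid n k (z(1 := y))) = 0" if "y \<noteq> 0" for y
  proof (rule no0)
    have "(z(1 := y)) j \<noteq> 0" if j: "j \<in> {1..k}" for j
    proof (cases "j = 1")
      case True
      then show ?thesis using \<open>y \<noteq> 0\<close> by simp
    next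
      case False
      then have "z j \<noteq> z 1" using inj_on_eq_iff[OF inj(1) j, of 1] j by simp
      then show ?thesis using z1 False by simp
    qed
    then show "0 \<notin> (z(1 := y)) ` {1..k}" by (metis (no_types, lifting) imageE)
  qed
  have "1 \<le> k" using i by simp
  have "0 < n" using inj(2) z1 \<open>1 \<le> k\<close> by force
  have "0 = (\<Sum>y<n. f (hook_tabloid n k (z(1 := y))))"
    using hook_cycles_boundary[OF f \<open>1 \<le> k\<close>] by simp
  also have "\<dots> = (\<Sum>y\<in>{0}. f (hook_tabloid n k (z(1 := y))))"
    using \<open>0 < n\<close> rest by (intro sum.mono_neutral_right) auto
  also have "\<dots> = f (hook_tabloid n k z)"
    using z1 by (simp add: fun_upd_idem)
  finally show False using nz' by simp
qed

lemma standard_hook_polytabloid: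
  assumes "k < n" "A \<subseteq> {1..<n}" "card A = k"
  shows "inj_on (standard_column A) {..k}" "standard_column A ` {..k} = insert 0 A"
    "standard_column A ` {..k} \<subseteq> {..<n}"
proof -
  have "finite A" "0 \<notin> A" using assms(2) finite_subset by auto
  from standard_column_bij_insert[OF this] assms(3)
  show inj: "inj_on (standard_column A) {..k}" and im: "standard_column A ` {..k} = insert 0 A"
    by (auto simp: bij_betw_def)
  show "standard_column A ` {..k} \<subseteq> {..<n}" using im assms(1,2) by auto
qed

text \<open>A permutation of \<open>A \<union> {0}\<close> that puts only nonzero letters into the rows \<open>1, \<dots>, k\<close> fills them with
  exactly \<open>A\<close>, so \<open>B = A\<close>; and since both fillings are sorted, it is the identity.\<close>
lemma standard_hook_polytabloid_dual:
  assumes k: "k < n" and A: "A \<subseteq> {1..<n}" "card A = k" and B: "B \<subseteq> {1..<n}" "card B = k"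
  shows "hook_polytabloid n k (standard_column A) (hook_tabloid n k (standard_column B))
    = of_bool (A = B)"
proof -
  have fin: "finite A" "finite B" and no0: "0 \<notin> A" "0 \<notin> B"
    using A B finite_subset by auto
  have imA: "standard_column A ` {1..k} = A" and imB: "standard_column B ` {1..k} = B"
    using standard_column_bij[OF fin(1)] standard_column_bij[OF fin(2)] A(2) B(2)
    by (auto simp: bij_betw_def)
  have iff: "(\<forall>i\<in>{1..k}. \<tau> (standard_column A i) = standard_column B i) \<longleftrightarrow> A = B \<and> \<tau> = id"
    if \<tau>: "\<tau> permutes insert 0 A" for \<tau>
  proof (intro iffI conjI)
    assume eq: "\<forall>i\<in>{1..k}. \<tau> (standard_column A i) = standard_column B i"
    have "\<tau> ` A = (\<lambda>i. \<tau> (standard_column A i)) ` {1..k}"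
      by (subst imA[symmetric]) (simp add: image_image)
    also have "\<dots> = standard_column B ` {1..k}" by (rule image_cong) (use eq in auto)
    finally have "\<tau> ` A = B" using imB by simp
    moreover have "\<tau> ` A \<subseteq> insert 0 A" using permutes_image[OF \<tau>] by auto
    ultimately have "B \<subseteq> A" using no0 by auto
    then show AB: "A = B" using A(2) B(2) fin card_subset_eq by metis
    have "\<tau> a = a" if "a \<in> A" for a
      using that eq unfolding AB by (metis imA AB imageE)
    moreover have "\<tau> x = x" if "x \<notin> insert 0 A" for x using \<tau> that by (simp add: permutes_not_in)
    ultimately have "\<tau> permutes {0}" using \<tau> by (intro permutes_superset[OF \<tau>]) auto
    then show "\<tau> = id" by simp
  qed auto
  have "hook_polytabloid n k (standard_column A) (hook_tabloid n k (standard_column B))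
      = (\<Sum>\<tau> | \<tau> permutes insert 0 A. of_int (sign \<tau>) * of_bool (A = B \<and> \<tau> = id))"
    unfolding hook_polytabloid_at_hook_tabloid standard_hook_polytabloid(2)[OF k A]
    by (intro sum.cong refl) (simp only: iff mem_Collect_eq)
  also have "\<dots> = (\<Sum>\<tau> | \<tau> permutes insert 0 A. if \<tau> = id then of_bool (A = B) else 0)"
    by (intro sum.cong refl) auto
  also have "\<dots> = of_bool (A = B)"
    using fin by (simp add: finite_permutations permutes_id)
  finally show ?thesis .
qed

lemma hook_cycle_expand:
  assumes k: "k < n" and f: "f \<in> hook_cycles n k"
  shows "f = (\<Sum>A | A \<subseteq> {1..<n} \<and> card A = k.
    scale_fun (f (hook_tabloid n k (standard_column A))) (hook_polytabloid n k (standard_column A)))"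
    (is "f = ?g")
proof -
  let ?I = "{A. A \<subseteq> {1..<n} \<and> card A = k}"
  have finI: "finite ?I" by (rule finite_subset[of _ "Pow {1..<n}"]) auto
  have "hook_polytabloid n k (standard_column A) \<in> hook_cycles n k" if "A \<in> ?I" for A
    using standard_hook_polytabloid[OF k, of A] that by (intro hook_polytabloid_in_hook_cycles) auto
  then have g: "?g \<in> hook_cycles n k"
    by (intro fun_vs.subspace_sum fun_vs.subspace_scale subspace_hook_cycles) auto
  have "f - ?g = 0"
  proof (rule hook_cycle_eq_0I)
    show "f - ?g \<in> hook_cycles n k"
      by (rule fun_vs.subspace_diff[OF subspace_hook_cycles f g])
    fix B assume B: "B \<subseteq> {1..<n}" "card B = k"
    have "?g (hook_tabloid n k (standard_column B))
        = (\<Sum>A\<in>?I. if A = B then f (hook_tabloid n k (standard_column B)) else 0)"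
      unfolding sum_fun_apply
      by (intro sum.cong refl) (auto simp: scale_fun_def standard_hook_polytabloid_dual[OF k _ _ B])
    also have "\<dots> = f (hook_tabloid n k (standard_column B))" using B finI by simp
    finally show "(f - ?g) (hook_tabloid n k (standard_column B)) = 0" by simp
  qed
  then show ?thesis by simp
qed

text \<open>Boundaries are cycles, and by the expansion above a cycle is a combination of polytabloids: the full
  simplex has no reduced homology.\<close>
lemma specht_module_hook_eq_cycles:
  assumes k: "k < n"
  shows "specht_module (hook n k) = hook_cycles n k"
proof
  show "specht_module (hook n k) \<subseteq> hook_cycles n k"
    unfolding specht_module_hook[OF k]
    by (intro fun_vs.span_minimal subspace_hook_cycles) (auto intro: hook_polytabloid_in_hook_cycles)
  show "hook_cycles n k \<subseteq> specht_module (hook n k)"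
  proof
    fix f assume f: "f \<in> hook_cycles n k"
    have "(\<Sum>A | A \<subseteq> {1..<n} \<and> card A = k.
        scale_fun (f (hook_tabloid n k (standard_column A)))
          (hook_polytabloid n k (standard_column A))) \<in> specht_module (hook n k)"
      unfolding specht_module_hook[OF k]
    proof (intro fun_vs.span_sum fun_vs.span_scale fun_vs.span_base)
      fix A assume "A \<in> {A. A \<subseteq> {1..<n} \<and> card A = k}"
      then show "hook_polytabloid n k (standard_column A)
          \<in> {hook_polytabloid n k a | a. inj_on a {..k} \<and> a ` {..k} \<subseteq> {..<n}}"
        using standard_hook_polytabloid[OF k, of A] by blast
    qed
    then show "f \<in> specht_module (hook n k)"
      by (subst hook_cycle_expand[OF k f])
  qed
qed

section \<open>Hook characters\<close>

lemma perm_action_hook_tabloid: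
  assumes \<sigma>: "\<sigma> permutes {..<n}"
  shows "perm_action \<sigma> f (hook_tabloid n k x) = f (hook_tabloid n k (inv \<sigma> \<circ> x))"
proof -
  have "bij (inv \<sigma>)" using \<sigma> permutes_inv permutes_bij by blast
  then have "inv \<sigma> ` ({..<n} - x ` {1..k}) = {..<n} - (inv \<sigma> \<circ> x) ` {1..k}"
    by (simp only: image_set_diff[OF bij_is_inj] permutes_image[OF permutes_inv[OF \<sigma>]] image_comp)
  then have "(\<lambda>i. inv \<sigma> ` hook_tabloid n k x i) = hook_tabloid n k (inv \<sigma> \<circ> x)"
    by (auto simp: hook_tabloid_def fun_eq_iff)
  then show ?thesis by (simp add: perm_action_def)
qed

lemma perm_action_hook_cycles:
  assumes \<sigma>: "\<sigma> permutes {..<n}" and f: "f \<in> hook_cycles n k"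
  shows "perm_action \<sigma> f \<in> hook_cycles n k"
proof -
  note inv\<sigma> = permutes_inv[OF \<sigma>]
  have supp: "\<exists>x. inj_on x {1..k} \<and> x ` {1..k} \<subseteq> {..<n} \<and> T = hook_tabloid n k x"
    if nz: "perm_action \<sigma> f T \<noteq> 0" for T
  proof -
    have "f (\<lambda>i. inv \<sigma> ` T i) \<noteq> 0" using nz by (simp add: perm_action_def)
    then obtain x where x: "inj_on x {1..k}" "x ` {1..k} \<subseteq> {..<n}"
      and T: "(\<lambda>i. inv \<sigma> ` T i) = hook_tabloid n k x"
      using f unfolding hook_cycles_def by blast
    have "T i = \<sigma> ` hook_tabloid n k x i" for i
    proof -
      have "T i = \<sigma> ` (inv \<sigma> ` T i)"
        using permutes_surj[OF \<sigma>] by (simp add: image_image surj_f_inv_f)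
      then show ?thesis using fun_cong[OF T, of i] by simp
    qed
    moreover have "\<sigma> ` ({..<n} - x ` {1..k}) = {..<n} - (\<sigma> \<circ> x) ` {1..k}"
      by (simp only: image_set_diff[OF permutes_inj[OF \<sigma>]] permutes_image[OF \<sigma>] image_comp)
    ultimately have "T = hook_tabloid n k (\<sigma> \<circ> x)"
      by (auto simp: hook_tabloid_def fun_eq_iff)
    moreover have "inj_on (\<sigma> \<circ> x) {1..k}" using x(1) permutes_inj_on[OF \<sigma>] by (rule comp_inj_on)
    moreover have "(\<sigma> \<circ> x) ` {1..k} \<subseteq> {..<n}"
      using x(2) permutes_image[OF \<sigma>] unfolding image_comp[symmetric] by blast
    ultimately show ?thesis by blast
  qed
  have alt: "perm_action \<sigma> f (hook_tabloid n k (x \<circ> \<rho>))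
      = of_int (sign \<rho>) * perm_action \<sigma> f (hook_tabloid n k x)"
    if "\<rho> permutes {1..k}" for x \<rho>
    using hook_cycles_alternating[OF f that, of "inv \<sigma> \<circ> x"]
    by (simp add: perm_action_hook_tabloid[OF \<sigma>] comp_assoc)
  have bd: "(\<Sum>y<n. perm_action \<sigma> f (hook_tabloid n k (x(1 := y)))) = 0" if "1 \<le> k" for x
  proof -
    have "inv \<sigma> \<circ> x(1 := y) = (inv \<sigma> \<circ> x)(1 := inv \<sigma> y)" for y by auto
    then have "(\<Sum>y<n. perm_action \<sigma> f (hook_tabloid n k (x(1 := y))))
        = (\<Sum>y<n. f (hook_tabloid n k ((inv \<sigma> \<circ> x)(1 := inv \<sigma> y))))"
      by (simp add: perm_action_hook_tabloid[OF \<sigma>])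
    also have "\<dots> = (\<Sum>y<n. f (hook_tabloid n k ((inv \<sigma> \<circ> x)(1 := y))))"
      by (rule sum.reindex_bij_betw[OF permutes_imp_bij[OF inv\<sigma>]])
    also have "\<dots> = 0" by (rule hook_cycles_boundary[OF f that])
    finally show ?thesis .
  qed
  show ?thesis by (rule hook_cyclesI) (fact supp alt bd)+
qed

lemma linear_perm_action: "Vector_Spaces.linear scale_fun scale_fun (perm_action \<sigma>)"
  by unfold_locales (auto simp: perm_action_def scale_fun_def fun_eq_iff algebra_simps)

text \<open>The diagonal matrix coefficients of \<open>\<sigma>\<close> in the basis of standard hook polytabloids, summed up. For each \<open>A\<close>
  there is at most one \<open>\<tau>\<close>.\<close>
definition hook_char :: "nat \<Rightarrow> nat \<Rightarrow> (nat \<Rightarrow> nat) \<Rightarrow> int" where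
  "hook_char n k \<sigma> = (\<Sum>A | A \<subseteq> {1..<n} \<and> card A = k.
      \<Sum>\<tau> | \<tau> permutes insert 0 A \<and> (\<forall>a\<in>A. \<tau> a = inv \<sigma> a). sign \<tau>)"

lemma specht_character_hook:
  assumes k: "k < n" and \<sigma>: "\<sigma> permutes {..<n}"
  shows "specht_character (hook n k) \<sigma> = of_int (hook_char n k \<sigma>)"
proof -
  let ?I = "{A. A \<subseteq> {1..<n} \<and> card A = k}"
  let ?e = "\<lambda>A. hook_polytabloid n k (standard_column A)"
  have "specht_character (hook n k) \<sigma> =
     (\<Sum>A\<in>?I. perm_action \<sigma> (?e A) (hook_tabloid n k (standard_column A)))"
    unfolding specht_character_def specht_module_hook_eq_cycles[OF k]
  proof (rule trace_on_eq_sum_evaluations)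
    show "?e A \<in> hook_cycles n k" if "A \<in> ?I" for A
      using standard_hook_polytabloid[OF k, of A] that
      by (intro hook_polytabloid_in_hook_cycles) auto
  qed (use hook_cycle_expand[OF k] perm_action_hook_cycles[OF \<sigma>]
      in \<open>auto simp: subspace_hook_cycles linear_perm_action\<close>)
  also have "\<dots> = (\<Sum>A\<in>?I. of_int
      (\<Sum>\<tau> | \<tau> permutes insert 0 A \<and> (\<forall>a\<in>A. \<tau> a = inv \<sigma> a). sign \<tau>))"
  proof (rule sum.cong[OF refl])
    fix A assume "A \<in> ?I"
    then have A: "A \<subseteq> {1..<n}" "card A = k" by auto
    then have fin: "finite A" using finite_subset by auto
    have im: "standard_column A ` {1..k} = A"
      using standard_column_bij[OF fin] A(2) by (auto simp: bij_betw_def)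
    have "(\<forall>i\<in>{1..k}. \<tau> (standard_column A i) = (inv \<sigma> \<circ> standard_column A) i)
        \<longleftrightarrow> (\<forall>a\<in>A. \<tau> a = inv \<sigma> a)" for \<tau>
      by (subst (2) im[symmetric]) simp
    then have "perm_action \<sigma> (?e A) (hook_tabloid n k (standard_column A))
        = (\<Sum>\<tau> | \<tau> permutes insert 0 A. of_int (sign \<tau>) * of_bool (\<forall>a\<in>A. \<tau> a = inv \<sigma> a))"
      unfolding perm_action_hook_tabloid[OF \<sigma>] hook_polytabloid_at_hook_tabloid
        standard_hook_polytabloid(2)[OF k A] by simp
    also have "\<dots> = (\<Sum>\<tau> | \<tau> permutes insert 0 A \<and> (\<forall>a\<in>A. \<tau> a = inv \<sigma> a). of_int (sign \<tau>))"
      using fin by (intro sum.mono_neutral_cong_right) (auto simp: finite_permutations)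
    finally show "perm_action \<sigma> (?e A) (hook_tabloid n k (standard_column A)) =
        of_int (\<Sum>\<tau> | \<tau> permutes insert 0 A \<and> (\<forall>a\<in>A. \<tau> a = inv \<sigma> a). sign \<tau>)"
      by simp
  qed
  finally show ?thesis by (simp add: hook_char_def)
qed

section \<open>Orbits and signs\<close>

lemma orbits_eq_or_disjoint:
  assumes "permutation p"
  shows "orbit p a = orbit p b \<or> orbit p a \<inter> orbit p b = {}"
proof (cases "orbit p a \<inter> orbit p b = {}")
  case False
  then obtain c where "c \<in> orbit p a" "c \<in> orbit p b" by blast
  then have "orbit p c = orbit p a" "orbit p c = orbit p b"
    using assms by (meson orbit_cyclic_eq3 cyclic_on_def permutation_self_in_orbit cyclic_on_orbit')+
  then show ?thesis by simp
qed simp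

lemma orbit_eq_iff_mem:
  assumes "permutation p"
  shows "orbit p a = orbit p b \<longleftrightarrow> a \<in> orbit p b"
  using orbits_eq_or_disjoint[OF assms, of a b] permutation_self_in_orbit[OF assms] by blast

text \<open>Multiplying by the transposition of \<open>x\<close> and \<open>p x\<close> cuts the point \<open>x\<close> out of its cycle.\<close>
lemma orbit_transpose_comp:
  assumes p: "inj p" and x: "p x \<noteq> x" and z: "z \<noteq> x"
  shows "orbit (transpose x (p x) \<circ> p) z = orbit p z - {x}" (is "orbit ?q z = _")
proof -
  have q: "?q w = (if p w = x then p x else p w)" "?q w \<noteq> x" if "w \<noteq> x" for w
    using that x injD[OF p, of w x] by (auto simp: transpose_def)
  show ?thesis
  proof (intro equalityI subsetI)
    fix w assume "w \<in> orbit ?q z"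
    then show "w \<in> orbit p z - {x}"
    proof induction
      case base
      show ?case using q[OF z] orbit.base[of p z] orbit.step[OF orbit.base[of p z]]
        by (auto split: if_splits)
    next
      case (step w)
      then have "w \<noteq> x" "w \<in> orbit p z" by auto
      then show ?case using q[of w] orbit.step[of w p z] orbit.step[OF orbit.step[of w p z]]
        by (auto split: if_splits)
    qed
  next
    fix w assume "w \<in> orbit p z - {x}"
    then have "w \<in> orbit p z" "w \<noteq> x" by auto
    from this(1) have "(if w = x then p x else w) \<in> orbit ?q z"
    proof induction
      case base
      show ?case using q(1)[OF z] orbit.base[of ?q z] by (simp del: comp_apply)
    next
      case (step w)
      show ?case
      proof (cases "w = x")
        case True
        then show ?thesis using step x by simp
      next
        case False
        then show ?thesis using step q(1)[of w] orbit.step[of w ?q z] by (simp del: comp_apply)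
      qed
    qed
    with \<open>w \<noteq> x\<close> show "w \<in> orbit ?q z" by simp
  qed
qed

text \<open>A cycle of length \<open>c\<close> has sign \<open>(-1)\<^bsup>c - 1\<^esup>\<close>, written here with exponent \<open>c + 1\<close>. The induction removes one point:
  a fixed point changes nothing, and cutting a point out of a longer cycle reverses the sign on both
  sides.\<close>
lemma sign_eq_prod_orbits:
  assumes "finite S" "p permutes S"
  shows "sign p = (\<Prod>C\<in>orbit p ` S. (-1) ^ (card C + 1))"
  using assms
proof (induction S arbitrary: p rule: finite_induct)
  case empty
  then show ?case by simp
next
  case (insert x S)
  have perm: "permutation p" using insert.prems insert.hyps(1) permutes_imp_permutation by blast
  show ?case
  proof (cases "p x = x")
    case True
    have pS: "p permutes S"
      using insert.prems True by (intro permutes_superset[OF insert.prems]) auto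
    have orb: "orbit p x = {x}" using True by (simp add: orbit_eq_singleton_iff)
    have "{x} \<notin> orbit p ` S"
    proof
      assume "{x} \<in> orbit p ` S"
      then obtain y where "y \<in> S" "orbit p y = {x}" by auto
      then show False using permutation_self_in_orbit[OF perm, of y] insert.hyps(2) by auto
    qed
    then show ?thesis using insert.IH[OF pS] insert.hyps(1) by (simp add: orb)
  next
    case False
    define q where "q = transpose x (p x) \<circ> p"
    have qS: "q permutes S" unfolding q_def by (rule permutes_insert_lemma[OF insert.prems])
    have px: "p x \<in> S" using permutes_in_image[OF insert.prems, of x] False by auto
    have "p = transpose x (p x) \<circ> q" by (simp add: q_def comp_assoc[symmetric])
    then have sign_p: "sign p = - sign q"
      using sign_compose[OF permutation_swap_id, of q x "p x"] False
        permutes_imp_permutation[OF insert.hyps(1) qS] by (simp add: sign_swap_id)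
    have orb_x: "orbit p x = orbit p (p x)" by (rule permutation_orbit_step[OF perm, symmetric])
    have orb_q: "orbit q ` S = (\<lambda>C. C - {x}) ` orbit p ` S"
    proof -
      have "orbit q z = orbit p z - {x}" if "z \<in> S" for z
        unfolding q_def using that insert.hyps(2) False
        by (intro orbit_transpose_comp permutes_inj[OF insert.prems]) auto
      then show ?thesis by (simp add: image_image)
    qed
    have inj: "inj_on (\<lambda>C. C - {x}) (orbit p ` S)"
    proof (rule inj_onI)
      fix C D assume CD: "C \<in> orbit p ` S" "D \<in> orbit p ` S" "C - {x} = D - {x}"
      then obtain c d where c: "c \<in> S" "C = orbit p c" and d: "d \<in> S" "D = orbit p d" by auto
      have "c \<in> C - {x}" using c insert.hyps(2) permutation_self_in_orbit[OF perm] by auto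
      then have "c \<in> D" using CD(3) by auto
      then show "C = D" using c d orbit_eq_iff_mem[OF perm] by auto
    qed
    define w :: "'a set \<Rightarrow> int" where "w C = (-1) ^ (card C + 1)" for C
    define C0 where "C0 = orbit p x"
    define R where "R = orbit p ` S - {C0}"
    have C: "C0 \<in> orbit p ` S" using px orb_x by (auto simp: C0_def)
    have remove: "(\<Prod>C\<in>orbit p ` S. f C) = f C0 * (\<Prod>C\<in>R. f C)" for f :: "'a set \<Rightarrow> int"
      unfolding R_def using insert.hyps(1) C by (intro prod.remove) auto
    have "(\<Prod>C\<in>R. w (C - {x})) = (\<Prod>C\<in>R. w C)"
    proof (intro prod.cong refl)
      fix C assume "C \<in> R"
      then obtain c where c: "C = orbit p c" "C \<noteq> C0" by (auto simp: R_def)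
      then have "x \<notin> C" using orbit_eq_iff_mem[OF perm, of x c] by (auto simp: C0_def)
      then show "w (C - {x}) = w C" by simp
    qed
    moreover have "w (C0 - {x}) = - w C0"
    proof -
      have x: "x \<in> C0" unfolding C0_def by (rule permutation_self_in_orbit[OF perm])
      then have "finite C0" unfolding C0_def by (rule finite_orbit)
      from card_Suc_Diff1[OF this x] have "card C0 = Suc (card (C0 - {x}))" by simp
      then show ?thesis by (simp add: w_def)
    qed
    moreover have "sign q = (\<Prod>C\<in>orbit p ` S. w (C - {x}))"
      unfolding insert.IH[OF qS] orb_q by (simp add: prod.reindex[OF inj] w_def)
    ultimately have "sign q = - (\<Prod>C\<in>orbit p ` S. w C)"
      using remove[of w] remove[of "\<lambda>C. w (C - {x})"] by simp
    then have "sign p = (\<Prod>C\<in>orbit p ` S. w C)" by (simp add: sign_p)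
    moreover have "orbit p ` insert x S = orbit p ` S" using C by (auto simp: C0_def)
    ultimately show ?thesis by (simp add: w_def)
  qed
qed

section \<open>The generating function of almost invariant sets\<close>

lemma prod_one_minus_expand:
  fixes f :: "'a \<Rightarrow> 'b::comm_ring_1"
  assumes "finite X"
  shows "(\<Prod>x\<in>X. 1 - f x) = (\<Sum>Y\<in>Pow X. \<Prod>x\<in>Y. - f x)"
  using prod_add[OF assms, of "\<lambda>x. - f x" "\<lambda>_. 1"] by simp

text \<open>A set \<open>A\<close> avoiding the base point \<open>x\<close> is almost invariant if \<open>\<sigma>\<inverse>\<close> maps it into \<open>A \<union> {x}\<close>. The
  restriction of \<open>\<sigma>\<inverse>\<close> to such a set has a unique completion to a permutation of \<open>A \<union> {x}\<close>. The
  almost invariant sets are parametrized by pairs \<open>(r, X)\<close>: the first \<open>r\<close> points after \<open>x\<close> on the cycle of \<open>x\<close>,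
  and a set \<open>X\<close> of other cycles.\<close>
context
  fixes S :: "'a set" and \<sigma> :: "'a \<Rightarrow> 'a" and x :: 'a
  assumes finS: "finite S" and \<sigma>: "\<sigma> permutes S" and x: "x \<in> S"
begin

private lemma perm: "permutation \<sigma>"
  using finS \<sigma> permutes_imp_permutation by blast

private lemma inv_perm: "permutation (inv \<sigma>)" and inv_\<sigma>: "inv \<sigma> permutes S"
  using perm permutation_inverse \<sigma> permutes_inv by auto

private lemma orbit_inv: "orbit (inv \<sigma>) = orbit \<sigma>"
  by (intro ext orbit_inv_eq perm)

private definition iter :: "nat \<Rightarrow> 'a" where "iter i = (\<sigma> ^^ i) x"
private abbreviation len :: nat where "len \<equiv> card (orbit \<sigma> x)"
private abbreviation others :: "'a set set" where "others \<equiv> orbit \<sigma> ` S - {orbit \<sigma> x}"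
private definition almost_invariant :: "'a set set" where
  "almost_invariant = {A. A \<subseteq> S - {x} \<and> inv \<sigma> ` A \<subseteq> insert x A}"
private definition assemble :: "nat \<Rightarrow> 'a set set \<Rightarrow> 'a set" where
  "assemble r X = iter ` {1..r} \<union> \<Union>X"
private definition completions :: "'a set \<Rightarrow> ('a \<Rightarrow> 'a) set" where
  "completions A = {\<tau>. \<tau> permutes insert x A \<and> (\<forall>a\<in>A. \<tau> a = inv \<sigma> a)}"

private lemma iter_bij: "bij_betw iter {..<len} (orbit \<sigma> x)" and iter_len: "iter len = x"
  and len_pos: "0 < len"
proof -
  have self: "x \<in> orbit \<sigma> x" by (rule permutation_self_in_orbit[OF perm])
  let ?m = "funpow_dist1 \<sigma> x x"
  have "inj_on iter {0..<?m}" unfolding iter_def[abs_def] by (rule inj_on_funpow_dist1[OF self])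
  moreover have "orbit \<sigma> x = iter ` {0..<?m}"
    unfolding iter_def[abs_def] by (rule orbit_conv_funpow_dist1[OF self])
  ultimately have bij: "bij_betw iter {..<?m} (orbit \<sigma> x)"
    by (simp add: bij_betw_def atLeast0LessThan)
  from bij_betw_same_card[OF this] have m: "len = ?m" by simp
  show "bij_betw iter {..<len} (orbit \<sigma> x)" using bij by (simp only: m)
  show "iter len = x" unfolding m iter_def by (rule funpow_dist1_prop[OF self])
  show "0 < len" unfolding m by simp
qed

private lemma iter_0: "iter 0 = x"
  by (simp add: iter_def)

private lemma inv_iter_Suc: "inv \<sigma> (iter (Suc i)) = iter i"
  using permutes_inj[OF \<sigma>] by (simp add: iter_def inv_f_f)

private lemma iter_eq_x_iff: "i < len \<Longrightarrow> iter i = x \<longleftrightarrow> i = 0"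
  using inj_on_eq_iff[OF bij_betw_imp_inj_on[OF iter_bij], of i 0] len_pos by (simp add: iter_0)

private lemma others_disjoint:
  assumes "C \<in> others" "D \<in> orbit \<sigma> ` S" "C \<noteq> D"
  shows "C \<inter> D = {}"
proof -
  obtain c d where "C = orbit \<sigma> c" "D = orbit \<sigma> d" using assms(1,2) by blast
  then show ?thesis using assms(3) orbits_eq_or_disjoint[OF perm, of c d] by simp
qed

private lemma others_disjoint_orbit: "X \<subseteq> others \<Longrightarrow> \<Union>X \<inter> orbit \<sigma> x = {}"
proof -
  assume X: "X \<subseteq> others"
  have "C \<inter> orbit \<sigma> x = {}" if "C \<in> X" for C
  proof (rule others_disjoint)
    show "C \<in> others" "C \<noteq> orbit \<sigma> x" using X that by auto
    show "orbit \<sigma> x \<in> orbit \<sigma> ` S" using x by simp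
  qed
  then show ?thesis by blast
qed

private lemma in_others:
  assumes "C \<in> others"
  shows "C \<subseteq> S" and "a \<in> C \<Longrightarrow> orbit \<sigma> a = C"
proof -
  from assms obtain c where c: "c \<in> S" "C = orbit \<sigma> c" by blast
  show "C \<subseteq> S" using permutes_orbit_subset[OF \<sigma> c(1)] c(2) by simp
  show "orbit \<sigma> a = C" if "a \<in> C"
    using that c(2) orbit_eq_iff_mem[OF perm, of a c] by simp
qed

private lemma fin_others: "finite others" "C \<in> others \<Longrightarrow> finite C"
proof -
  show "finite others" using finS by simp
  show "finite C" if "C \<in> others" using finite_subset[OF in_others(1)[OF that] finS] .
qed

private lemma x_in_orbit: "x \<in> orbit \<sigma> x"
  by (rule permutation_self_in_orbit[OF perm])

private lemma prefix_subset_orbit: "iter ` {1..r} \<subseteq> orbit \<sigma> x"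
  unfolding iter_def[abs_def] by (intro image_subsetI funpow_in_orbit x_in_orbit)

private lemma assemble_almost_invariant:
  assumes r: "r < len" and X: "X \<subseteq> others"
  shows "assemble r X \<in> almost_invariant"
proof -
  have "assemble r X \<subseteq> S"
  proof -
    have "iter ` {1..r} \<subseteq> S"
      using prefix_subset_orbit permutes_orbit_subset[OF \<sigma> x] by (rule subset_trans)
    moreover have "C \<subseteq> S" if "C \<in> X" for C using X that by (intro in_others(1)) auto
    ultimately show ?thesis unfolding assemble_def by blast
  qed
  moreover have "x \<notin> assemble r X"
  proof -
    have "iter i \<noteq> x" if "i \<in> {1..r}" for i using iter_eq_x_iff[of i] that r by simp
    then have "x \<notin> iter ` {1..r}" by (metis imageE)
    moreover have "x \<notin> \<Union>X" using others_disjoint_orbit[OF X] x_in_orbit by blast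
    ultimately show ?thesis unfolding assemble_def by blast
  qed
  moreover have "inv \<sigma> a \<in> insert x (assemble r X)" if a: "a \<in> assemble r X" for a
    using a unfolding assemble_def
  proof
    assume "a \<in> iter ` {1..r}"
    then obtain i where i: "i \<in> {1..r}" "a = iter i" by blast
    then obtain j where "i = Suc j" by (cases i) auto
    with i have "inv \<sigma> a = iter j" "j = 0 \<or> j \<in> {1..r}" using inv_iter_Suc[of j] by auto
    then show "inv \<sigma> a \<in> insert x (iter ` {1..r} \<union> \<Union>X)" using iter_0 by auto
  next
    assume "a \<in> \<Union>X"
    then obtain C where C: "C \<in> X" "a \<in> C" by blast
    from C(1) X have "C \<in> others" by blast
    from in_others(2)[OF this C(2)] have "orbit \<sigma> a = C" .
    then have "inv \<sigma> a \<in> C" using orbit.base[of "inv \<sigma>" a] by (simp add: orbit_inv)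
    with C show "inv \<sigma> a \<in> insert x (iter ` {1..r} \<union> \<Union>X)" by blast
  qed
  ultimately show ?thesis by (auto simp: almost_invariant_def)
qed

private lemma assemble_Int_orbit:
  assumes r: "r < len" and X: "X \<subseteq> others"
  shows "card (assemble r X \<inter> orbit \<sigma> x) = r"
proof -
  have "assemble r X \<inter> orbit \<sigma> x = iter ` {1..r}"
    using prefix_subset_orbit others_disjoint_orbit[OF X] by (auto simp: assemble_def)
  moreover have "inj_on iter {1..r}"
    using r by (intro inj_on_subset[OF bij_betw_imp_inj_on[OF iter_bij]]) auto
  ultimately show ?thesis by (simp add: card_image)
qed

private lemma assemble_others:
  assumes X: "X \<subseteq> others"
  shows "{C \<in> others. C \<subseteq> assemble r X} = X"
proof (intro equalityI subsetI)
  fix C assume "C \<in> X"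
  then show "C \<in> {C \<in> others. C \<subseteq> assemble r X}" using X by (auto simp: assemble_def)
next
  fix C assume "C \<in> {C \<in> others. C \<subseteq> assemble r X}"
  then have C: "C \<in> others" "C \<subseteq> assemble r X" by auto
  then obtain c where c: "C = orbit \<sigma> c" by blast
  then have "c \<in> C" using permutation_self_in_orbit[OF perm, of c] by simp
  moreover have "c \<notin> orbit \<sigma> x" using c C(1) orbit_eq_iff_mem[OF perm, of c x] by auto
  ultimately obtain D where D: "D \<in> X" "c \<in> D"
    using C(2) prefix_subset_orbit[of r] unfolding assemble_def by blast
  from D(1) X have "D \<in> others" by blast
  from in_others(2)[OF this D(2)] have "orbit \<sigma> c = D" .
  then show "C \<in> X" using c D by simp
qed

text \<open>Along the cycle of \<open>x\<close>, let \<open>r\<close> be the number of consecutive points after \<open>x\<close> lying in \<open>A\<close>. A later point of the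
  cycle cannot belong to \<open>A\<close>, since stepping back from it would lead to the first missing point. Off this cycle
  \<open>A\<close> is closed under \<open>\<sigma>\<inverse>\<close>, so it is a union of cycles.\<close>
private lemma almost_invariant_assemble:
  assumes A: "A \<in> almost_invariant"
  obtains r X where "r < len" "X \<subseteq> others" "A = assemble r X"
proof -
  have AS: "A \<subseteq> S" and xA: "x \<notin> A" and closed: "\<And>a. a \<in> A \<Longrightarrow> inv \<sigma> a \<noteq> x \<Longrightarrow> inv \<sigma> a \<in> A"
    using A by (auto simp: almost_invariant_def)
  define r where "r = (LEAST i. iter (Suc i) \<notin> A)"
  have ex: "iter (Suc (len - 1)) \<notin> A" using iter_len len_pos xA by simp
  have r_len: "r < len"
    using Least_le[of "\<lambda>i. iter (Suc i) \<notin> A", OF ex] len_pos unfolding r_def by linarith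
  have r_notin: "iter (Suc r) \<notin> A"
    unfolding r_def by (rule LeastI[of "\<lambda>i. iter (Suc i) \<notin> A", OF ex])
  have below: "iter i \<in> A" if "i \<in> {1..r}" for i
  proof -
    from that obtain j where j: "i = Suc j" "j < r" by (cases i) auto
    then show ?thesis using not_less_Least[of j "\<lambda>i. iter (Suc i) \<notin> A"] unfolding r_def by blast
  qed
  have above: "iter (Suc r + d) \<notin> A" if "Suc r + d < len" for d
    using that
  proof (induction d)
    case 0
    then show ?case using r_notin by simp
  next
    case (Suc d)
    have "inv \<sigma> (iter (Suc r + Suc d)) = iter (Suc r + d)"
      using inv_iter_Suc[of "Suc r + d"] by simp
    moreover have "iter (Suc r + d) \<noteq> x" using Suc.prems iter_eq_x_iff[of "Suc r + d"] by simp
    moreover have "iter (Suc r + d) \<notin> A" using Suc by simp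
    ultimately show ?case using closed[of "iter (Suc r + Suc d)"] by metis
  qed
  have onorb: "A \<inter> orbit \<sigma> x = iter ` {1..r}"
  proof (intro equalityI subsetI)
    fix a assume "a \<in> A \<inter> orbit \<sigma> x"
    then obtain i where i: "i < len" "a = iter i" "a \<in> A"
      using bij_betw_imp_surj_on[OF iter_bij] by (metis IntD1 IntD2 imageE lessThan_iff)
    have "i \<noteq> 0" using i xA iter_0 by metis
    moreover have "i \<le> r"
    proof (rule ccontr)
      assume "\<not> i \<le> r"
      then have "i = Suc r + (i - Suc r)" by simp
      with above[of "i - Suc r"] i show False by simp
    qed
    ultimately show "a \<in> iter ` {1..r}" using i by auto
  qed (use below prefix_subset_orbit in auto)
  define X where "X = orbit \<sigma> ` (A - orbit \<sigma> x)"
  have X: "X \<subseteq> others"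
  proof
    fix C assume "C \<in> X"
    then obtain a where a: "a \<in> A" "a \<notin> orbit \<sigma> x" "C = orbit \<sigma> a" by (auto simp: X_def)
    then show "C \<in> others" using AS orbit_eq_iff_mem[OF perm, of a x] by auto
  qed
  have "\<Union>X = A - orbit \<sigma> x"
  proof (intro equalityI subsetI)
    fix a assume "a \<in> \<Union>X"
    then obtain b where b: "b \<in> A" "b \<notin> orbit \<sigma> x" and a: "a \<in> orbit \<sigma> b" by (auto simp: X_def)
    have step: "inv \<sigma> c \<in> A - orbit \<sigma> x" if "c \<in> A - orbit \<sigma> x" for c
    proof -
      have "orbit \<sigma> (inv \<sigma> c) = orbit \<sigma> c"
        using permutation_orbit_step[OF inv_perm, of c] by (simp add: orbit_inv)
      then have "inv \<sigma> c \<notin> orbit \<sigma> x"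
        using that orbit_eq_iff_mem[OF perm, of "inv \<sigma> c" x] orbit_eq_iff_mem[OF perm, of c x] by simp
      moreover from this have "inv \<sigma> c \<noteq> x" using x_in_orbit by metis
      ultimately show ?thesis using closed[of c] that by simp
    qed
    from a have "a \<in> orbit (inv \<sigma>) b" by (simp add: orbit_inv)
    then show "a \<in> A - orbit \<sigma> x" by induction (use b step in simp_all)
  next
    fix a assume "a \<in> A - orbit \<sigma> x"
    then show "a \<in> \<Union>X" using permutation_self_in_orbit[OF perm, of a] by (auto simp: X_def)
  qed
  then have "A = assemble r X" using onorb by (auto simp: assemble_def)
  with r_len X show thesis by (rule that)
qed

text \<open>Two completions differ by a permutation fixing everything except possibly \<open>x\<close>.\<close>
private lemma completions_unique:
  assumes "x \<notin> A" "\<tau> \<in> completions A" "\<tau>' \<in> completions A"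
  shows "\<tau> = \<tau>'"
proof -
  have \<tau>: "\<tau> permutes insert x A" and \<tau>': "\<tau>' permutes insert x A"
    and eq: "\<And>a. a \<in> A \<Longrightarrow> \<tau> a = \<tau>' a"
    using assms by (auto simp: completions_def)
  have "inv \<tau>' \<circ> \<tau> permutes insert x A" using \<tau> \<tau>' by (intro permutes_compose permutes_inv)
  moreover have "(inv \<tau>' \<circ> \<tau>) a = a" if "a \<in> insert x A - {x}" for a
    using that eq permutes_inverses(2)[OF \<tau>'] by auto
  ultimately have "inv \<tau>' \<circ> \<tau> permutes {x}" by (rule permutes_superset)
  then have "inv \<tau>' \<circ> \<tau> = id" by simp
  then have "\<tau>' \<circ> (inv \<tau>' \<circ> \<tau>) = \<tau>'" by simp
  then show ?thesis using permutes_inv_o(1)[OF \<tau>'] by (simp add: comp_assoc[symmetric])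
qed

text \<open>The image of \<open>A\<close> misses exactly one point of \<open>A \<union> {x}\<close>, and \<open>x\<close> has to be sent there.\<close>
private lemma completions_nonempty_iff:
  assumes A: "A \<subseteq> S - {x}"
  shows "completions A \<noteq> {} \<longleftrightarrow> A \<in> almost_invariant"
proof
  assume "completions A \<noteq> {}"
  then obtain \<tau> where \<tau>: "\<tau> permutes insert x A" "\<And>a. a \<in> A \<Longrightarrow> \<tau> a = inv \<sigma> a"
    by (auto simp: completions_def)
  have "inv \<sigma> a \<in> insert x A" if "a \<in> A" for a
    using permutes_in_image[OF \<tau>(1), of a] \<tau>(2)[OF that] that by simp
  with A show "A \<in> almost_invariant" by (auto simp: almost_invariant_def)
next
  assume "A \<in> almost_invariant"
  then have sub: "inv \<sigma> ` A \<subseteq> insert x A" by (simp add: almost_invariant_def)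
  have fin: "finite A" and xA: "x \<notin> A" using A finS finite_subset by auto
  have inj: "inj_on (inv \<sigma>) A" using permutes_inj_on[OF inv_\<sigma>] .
  have "card (insert x A - inv \<sigma> ` A) = 1"
    using fin xA sub by (simp add: card_Diff_subset card_image[OF inj])
  then obtain z where z: "insert x A - inv \<sigma> ` A = {z}" by (rule card_1_singletonE)
  define \<tau> where "\<tau> = (\<lambda>a. if a \<in> A then inv \<sigma> a else if a = x then z else a)"
  have "bij_betw \<tau> A (inv \<sigma> ` A)"
    using inj by (subst bij_betw_cong[where g = "inv \<sigma>"]) (auto simp: \<tau>_def bij_betw_def)
  moreover have "bij_betw \<tau> {x} {z}" using xA by (simp add: \<tau>_def bij_betw_def)
  ultimately have "bij_betw \<tau> (A \<union> {x}) (inv \<sigma> ` A \<union> {z})"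
    using z by (intro bij_betw_combine) auto
  moreover have "A \<union> {x} = insert x A" "inv \<sigma> ` A \<union> {z} = insert x A" using z sub by auto
  ultimately have "bij_betw \<tau> (insert x A) (insert x A)" by simp
  then have "\<tau> permutes insert x A" by (rule bij_imp_permutes) (auto simp: \<tau>_def)
  then have "\<tau> \<in> completions A" by (simp add: completions_def \<tau>_def)
  then show "completions A \<noteq> {}" by blast
qed

text \<open>On the cycles in \<open>X\<close> the completion agrees with \<open>\<sigma>\<inverse>\<close>. The remaining points \<open>x, \<sigma> x, \<dots>, \<sigma>\<^sup>r x\<close> are
  closed into a single cycle: stepping back from each of them leads to \<open>x\<close>.\<close>
private lemma completion_orbits:
  assumes r: "r < len" and X: "X \<subseteq> others" and \<tau>: "\<tau> \<in> completions (assemble r X)"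
  shows "orbit \<tau> ` insert x (assemble r X) = insert (iter ` {..r}) X"
    and "iter ` {..r} \<notin> X"
proof -
  let ?A = "assemble r X"
  have perm\<tau>: "\<tau> permutes insert x ?A" and agree: "\<And>a. a \<in> ?A \<Longrightarrow> \<tau> a = inv \<sigma> a"
    using \<tau> by (auto simp: completions_def)
  have "?A \<subseteq> S" using assemble_almost_invariant[OF r X] by (auto simp: almost_invariant_def)
  then have "finite (insert x ?A)" using finS finite_subset by auto
  then have permut: "permutation \<tau>" using perm\<tau> permutes_imp_permutation by blast
  have orb_others: "orbit \<tau> a = C" if C: "C \<in> X" "a \<in> C" for a C
  proof -
    have "C \<in> others" using C X by blast
    from in_others(2)[OF this C(2)] have Ca: "orbit (inv \<sigma>) a = C" by (simp only: orbit_inv)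
    have "C \<subseteq> ?A" using C by (auto simp: assemble_def)
    then have "orbit \<tau> a = orbit (inv \<sigma>) a"
      using Ca agree permutation_self_in_orbit[OF inv_perm] by (intro orbit_cong) auto
    then show ?thesis using Ca by simp
  qed
  have iter0: "insert x (iter ` {1..r}) = iter ` {..r}"
  proof -
    have "{..r} = insert 0 {1..r}" by auto
    then show ?thesis by (simp add: iter_0)
  qed
  have mem: "iter i \<in> orbit \<tau> x" if "i \<le> r" for i
    using that
  proof (induction i)
    case 0
    then show ?case using permutation_self_in_orbit[OF permut, of x] by (simp add: iter_0)
  next
    case (Suc i)
    then have "iter (Suc i) \<in> ?A" by (auto simp: assemble_def)
    then have "\<tau> (iter (Suc i)) = iter i" using agree[of "iter (Suc i)"] inv_iter_Suc[of i] by simp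
    then have "orbit \<tau> (iter (Suc i)) = orbit \<tau> (iter i)"
      using permutation_orbit_step[OF permut, of "iter (Suc i)"] by simp
    moreover have "orbit \<tau> (iter i) = orbit \<tau> x"
      using Suc orbit_eq_iff_mem[OF permut, of "iter i" x] by simp
    ultimately show ?case using orbit_eq_iff_mem[OF permut, of "iter (Suc i)" x] by simp
  qed
  have orb_x: "orbit \<tau> x = iter ` {..r}"
  proof
    show "iter ` {..r} \<subseteq> orbit \<tau> x" using mem by auto
    have "orbit \<tau> x \<subseteq> insert x ?A" by (rule permutes_orbit_subset[OF perm\<tau>]) simp
    moreover have "orbit \<tau> x \<inter> \<Union>X = {}"
    proof (rule ccontr)
      assume "orbit \<tau> x \<inter> \<Union>X \<noteq> {}"
      then obtain a C where a: "a \<in> orbit \<tau> x" "C \<in> X" "a \<in> C" by blast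
      then have "orbit \<tau> x = C"
        using orb_others[OF a(2,3)] orbit_eq_iff_mem[OF permut, of a x] by simp
      then have "x \<in> C" using permutation_self_in_orbit[OF permut, of x] by simp
      then show False
        using \<open>C \<in> X\<close> others_disjoint_orbit[OF X] x_in_orbit by blast
    qed
    ultimately show "orbit \<tau> x \<subseteq> iter ` {..r}"
      unfolding iter0[symmetric] assemble_def by blast
  qed
  show "orbit \<tau> ` insert x ?A = insert (iter ` {..r}) X"
  proof (intro equalityI subsetI)
    fix C assume "C \<in> orbit \<tau> ` insert x ?A"
    then obtain a where a: "a \<in> insert x ?A" "C = orbit \<tau> a" by blast
    show "C \<in> insert (iter ` {..r}) X"
    proof (cases "a \<in> \<Union>X")
      case True
      then obtain D where "D \<in> X" "a \<in> D" by blast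
      then show ?thesis using orb_others[of D a] a(2) by simp
    next
      case False
      then have "a \<in> orbit \<tau> x" using a iter0 by (auto simp: assemble_def orb_x)
      then show ?thesis using a(2) orbit_eq_iff_mem[OF permut, of a x] orb_x by simp
    qed
  next
    fix C assume C: "C \<in> insert (iter ` {..r}) X"
    show "C \<in> orbit \<tau> ` insert x ?A"
    proof (cases "C \<in> X")
      case True
      with X obtain c where "C = orbit \<sigma> c" by blast
      then have "c \<in> C" using permutation_self_in_orbit[OF perm, of c] by simp
      with True have "orbit \<tau> c = C" "c \<in> ?A" using orb_others by (auto simp: assemble_def)
      then show ?thesis by blast
    next
      case False
      then show ?thesis using C orb_x by auto
    qed
  qed
  show "iter ` {..r} \<notin> X"
  proof
    assume "iter ` {..r} \<in> X"
    moreover have "x \<in> iter ` {..r}" using iter0 by auto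
    ultimately show False using others_disjoint_orbit[OF X] x_in_orbit by blast
  qed
qed

text \<open>The cycle through \<open>x\<close> has \<open>r + 1\<close> points but contributes only \<open>r\<close> to the size of \<open>A\<close>, so its sign
  \<open>(-1)\<^sup>r\<close> turns \<open>(- q)\<^sup>r\<close> into \<open>q\<^sup>r\<close>; every other cycle has opposite parities and leaves a minus sign.\<close>
private lemma completion_weight:
  fixes q :: "'b::comm_ring_1"
  assumes r: "r < len" and X: "X \<subseteq> others" and \<tau>: "\<tau> \<in> completions (assemble r X)"
  shows "of_int (sign \<tau>) * (- q) ^ card (assemble r X) = q ^ r * (\<Prod>C\<in>X. - (q ^ card C))"
proof -
  let ?A = "assemble r X"
  have "?A \<subseteq> S" using assemble_almost_invariant[OF r X] by (auto simp: almost_invariant_def)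
  then have fin: "finite ?A" "finite (insert x ?A)" using finS finite_subset by auto
  have finX: "finite X" using X fin_others(1) finite_subset by auto
  have inj: "inj_on iter {..r}"
    using r by (intro inj_on_subset[OF bij_betw_imp_inj_on[OF iter_bij]]) auto
  have perm\<tau>: "\<tau> permutes insert x ?A" using \<tau> by (simp add: completions_def)
  have card_A: "card ?A = r + (\<Sum>C\<in>X. card C)"
  proof -
    have "card (iter ` {1..r}) = r"
      using inj_on_subset[OF inj, of "{1..r}"] by (subst card_image) auto
    moreover have "card (\<Union>X) = (\<Sum>C\<in>X. card C)"
    proof (rule card_Union_disjoint)
      show "pairwise disjnt X"
      proof (rule pairwiseI)
        fix C D assume "C \<in> X" "D \<in> X" "C \<noteq> D"
        with X show "disjnt C D" unfolding disjnt_def by (intro others_disjoint) auto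
      qed
      show "finite C" if "C \<in> X" for C using X that by (intro fin_others(2)) auto
    qed
    moreover have "iter ` {1..r} \<inter> \<Union>X = {}"
      using prefix_subset_orbit others_disjoint_orbit[OF X] by blast
    moreover have "finite (\<Union>X)" using finX X fin_others(2) by (intro finite_Union) auto
    ultimately show ?thesis unfolding assemble_def by (subst card_Un_disjoint) auto
  qed
  have "sign \<tau> = (\<Prod>C\<in>insert (iter ` {..r}) X. (-1) ^ (card C + 1))"
    using sign_eq_prod_orbits[OF fin(2) perm\<tau>] completion_orbits(1)[OF r X \<tau>] by simp
  also have "\<dots> = (-1) ^ r * (\<Prod>C\<in>X. (-1) ^ (card C + 1))"
    using finX completion_orbits(2)[OF r X \<tau>] by (simp add: card_image[OF inj])
  finally have "of_int (sign \<tau>) * (- q) ^ card ?A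
      = ((-1) ^ r * (- q) ^ r) * ((\<Prod>C\<in>X. (-1) ^ (card C + 1)) * (\<Prod>C\<in>X. (- q) ^ card C))"
    unfolding card_A power_add power_sum by (simp add: algebra_simps)
  also have "(-1) ^ r * (- q) ^ r = q ^ r" by (simp flip: power_mult_distrib)
  also have "(\<Prod>C\<in>X. (-1) ^ (card C + 1)) * (\<Prod>C\<in>X. (- q) ^ card C) = (\<Prod>C\<in>X. - (q ^ card C))"
    unfolding prod.distrib[symmetric]
    by (intro prod.cong refl) (simp flip: power_mult_distrib)
  finally show ?thesis .
qed

lemma almost_invariant_generating_function:
  fixes q :: "'b::comm_ring_1"
  shows "(1 - q) * (\<Sum>A | A \<subseteq> S - {x}.
      \<Sum>\<tau> | \<tau> permutes insert x A \<and> (\<forall>a\<in>A. \<tau> a = inv \<sigma> a). of_int (sign \<tau>) * (- q) ^ card A)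
    = (\<Prod>C\<in>orbit \<sigma> ` S. 1 - q ^ card C)"
proof -
  have "(\<Sum>A | A \<subseteq> S - {x}. \<Sum>\<tau>\<in>completions A. of_int (sign \<tau>) * (- q) ^ card A)
      = (\<Sum>A\<in>almost_invariant. \<Sum>\<tau>\<in>completions A. of_int (sign \<tau>) * (- q) ^ card A)"
  proof (rule sum.mono_neutral_right)
    show "finite {A. A \<subseteq> S - {x}}" using finS by (simp flip: Pow_def)
    show "almost_invariant \<subseteq> {A. A \<subseteq> S - {x}}" by (auto simp: almost_invariant_def)
    show "\<forall>A\<in>{A. A \<subseteq> S - {x}} - almost_invariant.
        (\<Sum>\<tau>\<in>completions A. of_int (sign \<tau>) * (- q) ^ card A) = 0"
    proof
      fix A assume "A \<in> {A. A \<subseteq> S - {x}} - almost_invariant"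
      then have "completions A = {}" using completions_nonempty_iff[of A] by blast
      then show "(\<Sum>\<tau>\<in>completions A. of_int (sign \<tau>) * (- q) ^ card A) = 0" by simp
    qed
  qed
  also have "\<dots> = (\<Sum>(r, X)\<in>{..<len} \<times> Pow others. q ^ r * (\<Prod>C\<in>X. - (q ^ card C)))"
  proof (rule sum.reindex_bij_witness[where j = "\<lambda>A. (card (A \<inter> orbit \<sigma> x), {C \<in> others. C \<subseteq> A})"
        and i = "\<lambda>(r, X). assemble r X"])
    fix A assume A: "A \<in> almost_invariant"
    then obtain r X where rX: "r < len" "X \<subseteq> others" "A = assemble r X"
      by (rule almost_invariant_assemble)
    have j: "(card (A \<inter> orbit \<sigma> x), {C \<in> others. C \<subseteq> A}) = (r, X)"
      using rX assemble_Int_orbit assemble_others by simp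
    show "(case (card (A \<inter> orbit \<sigma> x), {C \<in> others. C \<subseteq> A}) of (r, X) \<Rightarrow> assemble r X) = A"
      and "(card (A \<inter> orbit \<sigma> x), {C \<in> others. C \<subseteq> A}) \<in> {..<len} \<times> Pow others"
      unfolding j using rX by auto
    have A': "A \<subseteq> S - {x}" using A by (simp add: almost_invariant_def)
    then obtain \<tau> where \<tau>: "\<tau> \<in> completions A" using A completions_nonempty_iff by blast
    then have "completions A = {\<tau>}" using completions_unique[of A] A' by blast
    then show "(case (card (A \<inter> orbit \<sigma> x), {C \<in> others. C \<subseteq> A}) of
        (r, X) \<Rightarrow> q ^ r * (\<Prod>C\<in>X. - (q ^ card C)))
      = (\<Sum>\<tau>\<in>completions A. of_int (sign \<tau>) * (- q) ^ card A)"
      unfolding j using completion_weight[OF rX(1,2), of \<tau> q] \<tau> rX(3) by simp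
  next
    fix rX assume "rX \<in> {..<len} \<times> Pow others"
    then obtain r X where rX: "rX = (r, X)" "r < len" "X \<subseteq> others" by auto
    then show "(case rX of (r, X) \<Rightarrow> assemble r X) \<in> almost_invariant"
      using assemble_almost_invariant by simp
    show "(card ((case rX of (r, X) \<Rightarrow> assemble r X) \<inter> orbit \<sigma> x),
        {C \<in> others. C \<subseteq> (case rX of (r, X) \<Rightarrow> assemble r X)}) = rX"
      using rX assemble_Int_orbit assemble_others by simp
  qed
  also have "\<dots> = (\<Sum>r<len. q ^ r) * (\<Prod>C\<in>others. 1 - q ^ card C)"
    unfolding prod_one_minus_expand[OF fin_others(1)]
    by (simp add: sum.cartesian_product[symmetric] sum_product)
  finally have "(1 - q) * (\<Sum>A | A \<subseteq> S - {x}. \<Sum>\<tau>\<in>completions A. of_int (sign \<tau>) * (- q) ^ card A)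
      = ((1 - q) * (\<Sum>r<len. q ^ r)) * (\<Prod>C\<in>others. 1 - q ^ card C)"
    by (simp add: mult.assoc)
  also have "(1 - q) * (\<Sum>r<len. q ^ r) = 1 - q ^ len"
    by (rule one_diff_power_eq[symmetric])
  also have "(1 - q ^ len) * (\<Prod>C\<in>others. 1 - q ^ card C) = (\<Prod>C\<in>orbit \<sigma> ` S. 1 - q ^ card C)"
    using finS x by (intro prod.remove[symmetric]) auto
  finally show ?thesis by (simp add: completions_def)
qed

end

section \<open>Permutations of prescribed cycle type\<close>

text \<open>A new part \<open>m\<close> is realized by a cycle on \<open>m\<close> fresh letters placed after the old ones.\<close>
lemma cycle_type_permutation_exists:
  assumes "\<forall>m\<in>set \<pi>. 0 < m"
  shows "\<exists>\<sigma>. \<sigma> permutes {..<sum_list \<pi>} \<and> cycle_type (sum_list \<pi>) \<sigma> = mset \<pi>"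
  using assms
proof (induction \<pi>)
  case Nil
  have "id permutes {..<sum_list []}" by (rule permutes_id)
  moreover have "cycle_type (sum_list []) id = mset []" by (simp add: cycle_type_def)
  ultimately show ?case by blast
next
  case (Cons m \<pi>)
  define n where "n = sum_list \<pi>"
  have m: "0 < m" using Cons.prems by simp
  obtain \<sigma> where \<sigma>: "\<sigma> permutes {..<n}" "cycle_type n \<sigma> = mset \<pi>"
    using Cons unfolding n_def by auto
  define \<rho> where
    "\<rho> = (\<lambda>i. if i < n then \<sigma> i else if Suc i = n + m then n else if i < n + m then Suc i else i)"
  have bij1: "bij_betw \<rho> {..<n} {..<n}"
    using permutes_imp_bij[OF \<sigma>(1)] by (subst bij_betw_cong[where g = \<sigma>]) (auto simp: \<rho>_def)
  have bij2: "bij_betw \<rho> {n..<n + m} {n..<n + m}"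
    by (rule bij_betw_byWitness[where f' = "\<lambda>i. if i = n then n + m - 1 else i - 1"])
      (use m in \<open>auto simp: \<rho>_def\<close>)
  have union: "{..<n} \<union> {n..<n + m} = {..<n + m}" by auto
  have "bij_betw \<rho> ({..<n} \<union> {n..<n + m}) ({..<n} \<union> {n..<n + m})"
    using bij1 bij2 by (rule bij_betw_combine) auto
  then have "bij_betw \<rho> {..<n + m} {..<n + m}" by (simp only: union)
  then have \<rho>: "\<rho> permutes {..<n + m}" by (rule bij_imp_permutes) (auto simp: \<rho>_def)
  have perm: "permutation \<rho>" using \<rho> permutes_imp_permutation by blast
  have perm\<sigma>: "permutation \<sigma>" using \<sigma>(1) permutes_imp_permutation by blast
  have old: "orbit \<rho> a = orbit \<sigma> a" if "a < n" for a
  proof (rule orbit_cong)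
    show "a \<in> orbit \<sigma> a" by (rule permutation_self_in_orbit[OF perm\<sigma>])
    fix s assume "s \<in> orbit \<sigma> a"
    then have "s < n" using permutes_orbit_subset[OF \<sigma>(1), of a] that by auto
    then show "\<rho> s = \<sigma> s" by (simp add: \<rho>_def)
  qed
  have orbit_n: "orbit \<rho> n = {n..<n + m}"
  proof
    show "orbit \<rho> n \<subseteq> {n..<n + m}"
    proof
      fix a assume "a \<in> orbit \<rho> n"
      then show "a \<in> {n..<n + m}"
        by induction (use m in \<open>auto simp: \<rho>_def split: if_splits\<close>)
    qed
    have "n + i \<in> orbit \<rho> n" if "i < m" for i
      using that
    proof (induction i)
      case 0
      then show ?case using permutation_self_in_orbit[OF perm, of n] by simp
    next
      case (Suc i)
      then have "\<rho> (n + i) = n + Suc i" by (simp add: \<rho>_def)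
      then show ?case using Suc orbit.step[of "n + i" \<rho> n] by simp
    qed
    then show "{n..<n + m} \<subseteq> orbit \<rho> n" by (auto simp: le_iff_add)
  qed
  have new: "orbit \<rho> a = {n..<n + m}" if "a \<in> {n..<n + m}" for a
    using that orbit_eq_iff_mem[OF perm, of a n] orbit_n by simp
  have "orbit \<rho> ` {..<n + m} = orbit \<rho> ` {..<n} \<union> orbit \<rho> ` {n..<n + m}"
    by (simp only: union[symmetric] image_Un)
  also have "orbit \<rho> ` {..<n} = orbit \<sigma> ` {..<n}" using old by (intro image_cong) auto
  also have "orbit \<rho> ` {n..<n + m} = (\<lambda>_. {n..<n + m}) ` {n..<n + m}"
    using new by (intro image_cong) auto
  also have "\<dots> = {{n..<n + m}}" using m by (simp add: image_constant_conv)
  finally have orbits: "orbit \<rho> ` {..<n + m} = insert {n..<n + m} (orbit \<sigma> ` {..<n})" by simp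
  have "{n..<n + m} \<notin> orbit \<sigma> ` {..<n}"
  proof
    assume "{n..<n + m} \<in> orbit \<sigma> ` {..<n}"
    then obtain a where a: "a < n" "{n..<n + m} = orbit \<sigma> a" by auto
    have "a \<in> {n..<n + m}" unfolding a(2) by (rule permutation_self_in_orbit[OF perm\<sigma>])
    with a(1) show False by simp
  qed
  then have "cycle_type (n + m) \<rho> = add_mset m (cycle_type n \<sigma>)"
    unfolding cycle_type_def orbits by simp
  with \<rho> \<sigma>(2) show ?case by (intro exI[of _ \<rho>]) (simp add: n_def add.commute)
qed

section \<open>The generating function of hook characters\<close>

unbundle fps_syntax

lemma hook_char_generating_function:
  fixes q :: "'b::comm_ring_1"
  assumes n: "1 \<le> n" and \<sigma>: "\<sigma> permutes {..<n}" "cycle_type n \<sigma> = mset \<pi>"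
  shows "(1 - q) * (\<Sum>k<n. of_int ((-1) ^ k * hook_char n k \<sigma>) * q ^ k) = (\<Prod>m\<leftarrow>\<pi>. 1 - q ^ m)"
proof -
  let ?T = "\<lambda>A. {\<tau>. \<tau> permutes insert 0 A \<and> (\<forall>a\<in>A. \<tau> a = inv \<sigma> a)}"
  let ?S = "{A. A \<subseteq> {1..<n}}"
  have S: "{..<n} - {0} = {1..<n}" by auto
  have finS: "finite ?S" by (simp flip: Pow_def)
  have "card A < n" if "A \<in> ?S" for A
    using that n card_mono[of "{1..<n}" A] by auto
  then have "(\<Sum>A\<in>?S. \<Sum>\<tau>\<in>?T A. of_int (sign \<tau>) * (- q) ^ card A)
      = (\<Sum>k<n. \<Sum>A\<in>{A \<in> ?S. card A = k}. \<Sum>\<tau>\<in>?T A. of_int (sign \<tau>) * (- q) ^ card A)"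
    using finS by (intro sum.group[symmetric]) auto
  also have "\<dots> = (\<Sum>k<n. of_int ((-1) ^ k * hook_char n k \<sigma>) * q ^ k)"
  proof (rule sum.cong[OF refl])
    fix k
    have "(\<Sum>A\<in>{A \<in> ?S. card A = k}. \<Sum>\<tau>\<in>?T A. of_int (sign \<tau>) * (- q) ^ card A)
        = (\<Sum>A | A \<subseteq> {1..<n} \<and> card A = k. \<Sum>\<tau>\<in>?T A. of_int (sign \<tau>)) * (- q) ^ k"
      unfolding sum_distrib_right by (intro sum.cong) auto
    then show "(\<Sum>A\<in>{A \<in> ?S. card A = k}. \<Sum>\<tau>\<in>?T A. of_int (sign \<tau>) * (- q) ^ card A)
        = of_int ((-1) ^ k * hook_char n k \<sigma>) * q ^ k"
      by (simp add: hook_char_def power_minus[of q] mult_ac)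
  qed
  finally have "(1 - q) * (\<Sum>k<n. of_int ((-1) ^ k * hook_char n k \<sigma>) * q ^ k)
      = (\<Prod>C\<in>orbit \<sigma> ` {..<n}. 1 - q ^ card C)"
    using almost_invariant_generating_function[OF _ \<sigma>(1), of 0 q] n by (simp only: S) simp
  also have "\<dots> = prod_mset (image_mset (\<lambda>m. 1 - q ^ m) (cycle_type n \<sigma>))"
    by (simp add: prod_unfold_prod_mset cycle_type_def multiset.map_comp comp_def)
  also have "\<dots> = (\<Prod>m\<leftarrow>\<pi>. 1 - q ^ m)"
    by (simp add: \<sigma>(2) prod_mset_prod_list flip: mset_map)
  finally show ?thesis .
qed

text \<open>The generating function depends only on the cycle type and \<open>1 - q\<close> can be cancelled when \<open>q\<close> is the
  power series variable, so the coefficients agree.\<close>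
lemma hook_char_cong_cycle_type:
  assumes n: "1 \<le> n" and k: "k < n"
    and \<sigma>: "\<sigma> permutes {..<n}" and \<sigma>': "\<sigma>' permutes {..<n}"
    and eq: "cycle_type n \<sigma> = cycle_type n \<sigma>'"
  shows "hook_char n k \<sigma> = hook_char n k \<sigma>'"
proof -
  obtain \<pi> where \<pi>: "cycle_type n \<sigma>' = mset \<pi>" using ex_mset by metis
  let ?P = "\<lambda>\<sigma>. \<Sum>k<n. of_int ((-1) ^ k * hook_char n k \<sigma>) * (fps_X :: int fps) ^ k"
  have coeff: "?P \<sigma> $ k = (-1) ^ k * hook_char n k \<sigma>" for \<sigma>
  proof -
    have "?P \<sigma> $ k = (\<Sum>i<n. if i = k then (-1) ^ k * hook_char n k \<sigma> else 0)"
      unfolding fps_sum_nth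
      by (intro sum.cong refl) (auto simp: fps_X_power_mult_right_nth fps_of_int[symmetric])
    then show ?thesis using k by simp
  qed
  have "(1 - fps_X) * ?P \<sigma> = (1 - fps_X) * ?P \<sigma>'"
    by (rule trans[OF hook_char_generating_function[OF n \<sigma> trans[OF eq \<pi>], of fps_X]
          hook_char_generating_function[OF n \<sigma>' \<pi>, of fps_X, symmetric]])
  moreover have "1 - fps_X \<noteq> (0 :: int fps)"
  proof
    assume "1 - fps_X = (0 :: int fps)"
    then have "(1 - fps_X) $ 0 = (0 :: int fps) $ 0" by simp
    then show False by simp
  qed
  ultimately have "?P \<sigma> = ?P \<sigma>'" by simp
  then have "?P \<sigma> $ k = ?P \<sigma>' $ k" by simp
  then show ?thesis unfolding coeff by simp
qed

lemma sym_char_hook: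
  assumes n: "1 \<le> n" and k: "k < n"
    and \<sigma>: "\<sigma> permutes {..<n}" and \<pi>: "cycle_type n \<sigma> = mset \<pi>"
  shows "sym_char (hook n k) \<pi> = of_int (hook_char n k \<sigma>)"
  unfolding sym_char_def sum_list_hook[OF k]
proof (rule the_equality)
  show "\<forall>\<sigma>'. \<sigma>' permutes {..<n} \<and> cycle_type n \<sigma>' = mset \<pi> \<longrightarrow>
      specht_character (hook n k) \<sigma>' = of_int (hook_char n k \<sigma>)"
  proof (intro allI impI)
    fix \<sigma>' assume \<sigma>': "\<sigma>' permutes {..<n} \<and> cycle_type n \<sigma>' = mset \<pi>"
    then have "hook_char n k \<sigma>' = hook_char n k \<sigma>"
      using \<sigma> \<pi> by (intro hook_char_cong_cycle_type[OF n k]) auto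
    then show "specht_character (hook n k) \<sigma>' = of_int (hook_char n k \<sigma>)"
      using specht_character_hook[OF k] \<sigma>' by simp
  qed
  fix c assume "\<forall>\<sigma>'. \<sigma>' permutes {..<n} \<and> cycle_type n \<sigma>' = mset \<pi> \<longrightarrow>
      specht_character (hook n k) \<sigma>' = c"
  then have "specht_character (hook n k) \<sigma> = c" using \<sigma> \<pi> by blast
  then show "c = of_int (hook_char n k \<sigma>)"
    using specht_character_hook[OF k \<sigma>] by simp
qed

section \<open>Moments\<close>

lemma one_minus_fps_exp:
  fixes a :: complex
  obtains U where "1 - fps_exp a = fps_X * U" "U $ 0 = - a"
proof
  define U where "U = Abs_fps (\<lambda>i. - (a ^ Suc i / fact (Suc i)))"
  show "U $ 0 = - a" by (simp add: U_def)
  show "1 - fps_exp a = fps_X * U"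
    by (rule fps_ext) (auto simp: U_def gr0_conv_Suc simp del: fact_Suc power_Suc)
qed

lemma prod_one_minus_fps_exp:
  fixes c :: complex
  obtains H where "(\<Prod>m\<leftarrow>\<pi>. 1 - fps_exp (of_nat m * c)) = fps_X ^ length \<pi> * H"
    "H $ 0 = (- c) ^ length \<pi> * of_nat (prod_list \<pi>)"
proof (induction \<pi> arbitrary: thesis)
  case Nil
  then show ?case using Nil[of 1] by simp
next
  case (Cons m \<pi>)
  obtain H where H: "(\<Prod>m\<leftarrow>\<pi>. 1 - fps_exp (of_nat m * c)) = fps_X ^ length \<pi> * H"
    "H $ 0 = (- c) ^ length \<pi> * of_nat (prod_list \<pi>)"
    by (rule Cons.IH)
  obtain U where U: "1 - fps_exp (of_nat m * c) = fps_X * U" "U $ 0 = - (of_nat m * c)"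
    by (rule one_minus_fps_exp)
  show ?case
  proof (rule Cons.prems[of "U * H"])
    have "(\<Prod>m\<leftarrow>m # \<pi>. 1 - fps_exp (of_nat m * c)) = fps_X * U * (fps_X ^ length \<pi> * H)"
      by (simp only: list.map prod_list.Cons U(1) H(1))
    then show "(\<Prod>m\<leftarrow>m # \<pi>. 1 - fps_exp (of_nat m * c)) = fps_X ^ length (m # \<pi>) * (U * H)"
      by (simp add: mult_ac)
    show "(U * H) $ 0 = (- c) ^ length (m # \<pi>) * of_nat (prod_list (m # \<pi>))"
      by (simp add: H U mult_ac)
  qed
qed

text \<open>The coefficient of \<open>X\<^sup>j\<close> in \<open>G = exp (b X) \<Sum>\<^sub>k c\<^sub>k exp (-2 X)\<^sup>k\<close> is the \<open>j\<close>-th moment divided by \<open>j!\<close>. One of the \<open>l(\<pi>)\<close>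
  factors \<open>X\<close> of the product cancels against \<open>1 - exp (-2 X) = X U\<close>, so \<open>G\<close> starts in degree \<open>l(\<pi>) - 1\<close>.\<close>
lemma moments_from_generating_function:
  fixes c :: "nat \<Rightarrow> int"
  assumes gf: "(1 - fps_exp (-2 :: complex)) * (\<Sum>k<n. of_int (c k) * fps_exp (-2) ^ k)
      = (\<Prod>m\<leftarrow>\<pi>. 1 - fps_exp (-2) ^ m)"
    and \<pi>: "\<pi> \<noteq> []" and j: "j \<le> length \<pi> - 1"
  shows "(\<Sum>k<n. of_int (c k) * (b - 2 * of_nat k) ^ j) =
    (if j = length \<pi> - 1
     then 2 ^ (length \<pi> - 1) * fact (length \<pi> - 1) * of_nat (prod_list \<pi>) else (0 :: complex))"
proof -
  define l where "l = length \<pi> - 1"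
  have len: "length \<pi> = Suc l" using \<pi> by (simp add: l_def)
  define G where "G = fps_exp b * (\<Sum>k<n. of_int (c k) * fps_exp (-2 :: complex) ^ k)"
  have "G = (\<Sum>k<n. fps_const (of_int (c k)) * fps_exp (b - 2 * of_nat k))"
    unfolding G_def sum_distrib_left
  proof (rule sum.cong[OF refl])
    fix k
    \<comment> \<open>the powers of \<open>exp (-2 X)\<close> turn the weights into the arithmetic progression \<open>b - 2 k\<close>\<close>
    have "fps_exp (b - 2 * of_nat k) = fps_exp b * fps_exp (-2) ^ k"
      by (simp add: fps_exp_power_mult mult.commute flip: fps_exp_add_mult)
    then show "fps_exp b * (of_int (c k) * fps_exp (-2) ^ k)
        = fps_const (of_int (c k)) * fps_exp (b - 2 * of_nat k)"
      by (simp add: fps_of_int mult_ac)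
  qed
  then have nth: "fact j * G $ j = (\<Sum>k<n. of_int (c k) * (b - 2 * of_nat k) ^ j)"
    by (simp add: fps_sum_nth sum_distrib_left)
  obtain U where U: "1 - fps_exp (-2) = fps_X * U" "U $ 0 = (2 :: complex)"
    using one_minus_fps_exp[of "-2"] by auto
  obtain H where H: "(\<Prod>m\<leftarrow>\<pi>. 1 - fps_exp (of_nat m * (-2 :: complex))) = fps_X ^ Suc l * H"
    "H $ 0 = 2 ^ Suc l * of_nat (prod_list \<pi>)"
    using prod_one_minus_fps_exp[where \<pi> = \<pi> and c = "-2"] len by auto
  have "fps_X * (U * G) = fps_X * (fps_X ^ l * (fps_exp b * H))"
    using gf H(1) unfolding U G_def by (simp add: fps_exp_power_mult mult_ac)
  then have "U * G = fps_X ^ l * (fps_exp b * H)" by simp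
  then have "inverse U * (U * G) = fps_X ^ l * (inverse U * (fps_exp b * H))"
    by (simp add: mult_ac)
  moreover have "inverse U * U = 1" using U(2) by (intro inverse_mult_eq_1) auto
  ultimately have "G = fps_X ^ l * (inverse U * (fps_exp b * H))"
    by (simp add: mult.assoc[symmetric])
  then have "G $ j = (if j < l then 0 else (inverse U * (fps_exp b * H)) $ (j - l))"
    by (simp only: fps_X_power_mult_nth)
  then have "G $ j = (if j = l then 2 ^ l * of_nat (prod_list \<pi>) else 0)"
    using j U(2) H(2) by (auto simp: l_def)
  then show ?thesis using nth[symmetric] by (simp add: l_def)
qed

theorem lemma4p2:
  fixes n j :: nat and \<pi> :: "nat list"
  assumes "n \<ge> 1" and "partition_of n \<pi>" and "j \<le> length \<pi> - 1"
  shows "(\<Sum>k=0..n-1. (-1) ^ k * sym_char (hook n k) \<pi> * of_int (int n - 2 * int k - 1) ^ j) =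
    (if j = length \<pi> - 1
     then 2 ^ (length \<pi> - 1) * fact (length \<pi> - 1) * (\<Prod>i<length \<pi>. of_nat (\<pi> ! i))
     else 0)"
proof -
  have pos: "\<forall>m\<in>set \<pi>. 0 < m" and sum: "sum_list \<pi> = n"
    using assms(2) by (auto simp: partition_of_def)
  obtain \<sigma> where \<sigma>: "\<sigma> permutes {..<n}" "cycle_type n \<sigma> = mset \<pi>"
    using cycle_type_permutation_exists[OF pos] sum by auto
  have "\<pi> \<noteq> []" using sum assms(1) by auto
  have "{0..n - 1} = {..<n}" using assms(1) by auto
  then have "(\<Sum>k=0..n-1. (-1) ^ k * sym_char (hook n k) \<pi> * of_int (int n - 2 * int k - 1) ^ j)
      = (\<Sum>k<n. of_int ((-1) ^ k * hook_char n k \<sigma>) * (of_nat n - 1 - 2 * of_nat k) ^ j)"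
    by (intro sum.cong) (auto simp: sym_char_hook[OF assms(1) _ \<sigma>] algebra_simps)
  also have "\<dots> = (if j = length \<pi> - 1
      then 2 ^ (length \<pi> - 1) * fact (length \<pi> - 1) * of_nat (prod_list \<pi>) else 0)"
    using hook_char_generating_function[OF assms(1) \<sigma>] \<open>\<pi> \<noteq> []\<close> assms(3)
    by (intro moments_from_generating_function)
  also have "of_nat (prod_list \<pi>) = (\<Prod>i<length \<pi>. of_nat (\<pi> ! i) :: complex)"
    by (simp add: prod.list_conv_set_nth atLeast0LessThan)
  finally show ?thesis .
qed

end
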